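(* Let $n\ge 3$. (1) $\mathcal{PI}^{\ast}_n$ is generated as an inverse semigroup by $\mathcal{S}_n\cup\{\gamma_{1,2}\}$. (2) For $u\in\mathcal{PI}^{\ast}_n\setminus\mathcal{S}_n$, $\mathcal{PI}^{\ast}_n$ is generated as an inverse semigroup by $\mathcal{S}_n\cup\{u\}$ if and only if $u\in \mathcal{S}_n\{\gamma_{1,2},\gamma_{1,2}^{-1}\}\mathcal{S}_n=\{g\star v\star h: g,h\in\mathcal{S}_n,\ v\in\{\gamma_{1,2},\gamma_{1,2}^{-1}\}\}$.
   Context: Let $X=\{1,\dots,n\}$, $X'=\{1',\dots,n'\}$ a disjoint copy. $\mathcal{PI}^{\ast}_n$ is the set of partitions of $X\cup X'$ each of whose blocks is a singleton (point) or a generalised line (a set meeting both $X$ and $X'$), with product $\star$: with $X''$ a third copy of $X$, regard $\alpha$ as a partition of $X\cup X''$ and $\beta$ as a partition of $X''\cup X'$, let $\sim$ be the equivalence relation on $X\cup X''\cup X'$ generated by the blocks of both; $\alpha\star\beta$ is the partition of $X\cup X'$ in which distinct $u,v$ lie in one block iff $u\sim v$ and the $\sim$-class of $u$ contains no singleton block of $\alpha$ or $\beta$. This is an inverse semigroup; the inverse of the element with generalised lines $A_i\cup B_i'$ is the element with generalised lines $B_i\cup A_i'$. $\mathcal{S}_n$ is its group of units: the elements all of whose blocks are of the form $\{x,\pi(x)'\}$ for a permutation $\pi$ of $X$. $\gamma_{1,2}$ is the element with blocks $\{1,2,1'\}$, $\{2'\}$, and $\{t,t'\}$ for $3\le t\le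 n$. *)

theory Defs
  imports Main
begin

text \<open>Points of the ground sets are pairs (i, t): t = 0 is the copy X, t = 1 the copy X',
  t = 2 the auxiliary copy X''. An element of the semigroup is a set of blocks.\<close>

type_synonym pt = "nat \<times> nat"
type_synonym bpart = "pt set set"

definition ground :: "nat \<Rightarrow> pt set" where
  "ground n = {(i, t). i \<in> {1..n} \<and> t \<in> {0, 1}}"

definition Xs :: "nat \<Rightarrow> pt set" where "Xs n = {(i, 0) | i. i \<in> {1..n}}"
definition Xp :: "nat \<Rightarrow> pt set" where "Xp n = {(i, 1) | i. i \<in> {1..n}}"

definition is_partition :: "pt set \<Rightarrow> bpart \<Rightarrow> bool" where
  "is_partition G P \<longleftrightarrow> (\<forall>B\<in>P. B \<noteq> {} \<and> B \<subseteq> G) \<and> \<Union>P = G \<and>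
     (\<forall>B\<in>P. \<forall>C\<in>P. B \<noteq> C \<longrightarrow> B \<inter> C = {})"

definition PIstar :: "nat \<Rightarrow> bpart set" where
  "PIstar n = {P. is_partition (ground n) P \<and>
     (\<forall>B\<in>P. (\<exists>x. B = {x}) \<or> (B \<inter> Xs n \<noteq> {} \<and> B \<inter> Xp n \<noteq> {}))}"

definition relabel :: "(nat \<Rightarrow> nat) \<Rightarrow> bpart \<Rightarrow> bpart" where
  "relabel f P = (\<lambda>B. (\<lambda>(i, t). (i, f t)) ` B) ` P"

definition star :: "nat \<Rightarrow> bpart \<Rightarrow> bpart \<Rightarrow> bpart" where
  "star n \<alpha> \<beta> =
    (let A = relabel (\<lambda>t. if t = 1 then 2 else t) \<alpha>;
         B = relabel (\<lambda>t. if t = 0 then 2 else t) \<beta>;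
         sim = {(u, v). \<exists>C \<in> A \<union> B. u \<in> C \<and> v \<in> C}\<^sup>*;
         good = (\<lambda>u. \<not> (\<exists>w. {w} \<in> A \<union> B \<and> (u, w) \<in> sim))
     in (\<lambda>u. if good u then {v \<in> ground n. (u, v) \<in> sim} else {u}) ` ground n)"

definition pinv :: "bpart \<Rightarrow> bpart" where
  "pinv P = relabel (\<lambda>t. if t = 0 then 1 else if t = 1 then 0 else t) P"

definition Sym :: "nat \<Rightarrow> bpart set" where
  "Sym n = {P. \<exists>\<pi>. bij_betw \<pi> {1..n} {1..n} \<and> P = (\<lambda>x. {(x, 0), (\<pi> x, 1)}) ` {1..n}}"

definition gamma12 :: "nat \<Rightarrow> bpart" where
  "gamma12 n = {{(1, 0), (2, 0), (1, 1)}, {(2, 1)}} \<union> (\<lambda>t. {(t, 0), (t, 1)}) ` {3..n}"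

inductive_set inv_gen :: "nat \<Rightarrow> bpart set \<Rightarrow> bpart set" for n G where
  base: "x \<in> G \<Longrightarrow> x \<in> inv_gen n G"
| mult: "x \<in> inv_gen n G \<Longrightarrow> y \<in> inv_gen n G \<Longrightarrow> star n x y \<in> inv_gen n G"
| inv: "x \<in> inv_gen n G \<Longrightarrow> pinv x \<in> inv_gen n G"

end

(* Label the points of X and of X' by functions f and g, giving label 0 to the singleton blocks and a
   common nonzero label to each generalised line.  Merging all singletons into one extra class makes
   the product a pushout of labellings, so it can be computed by composing functions.

   Generation: if a generalised line contains two points a, b of X, then b can be split off as a
   singleton by factoring out a conjugate of gamma.  Repeating this on both sides leaves a
   partial bijection, which is an idempotent times a permutation, and the idempotent is a product
   of conjugates of gamma^-1 gamma.

   Which u suffice: elements of rank at most n - 2 together with S_n, elements without singletons,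
   and partial bijections each form a closed set missing gamma.  So u has rank n - 1, a singleton,
   and a line with two points on one side.  Counting then puts the singleton on the other side, and
   u is gamma or its inverse up to permutations. *)

theory Submission
  imports Defs
begin

text \<open>The counting behind the last step: both labellings use the same nonzero labels, so once
  there are at least n - 1 of them each side has at most one point to spare. A spare point is used
  up either by sharing a label with another point or by carrying label 0. A shared label on one side
  therefore leaves that side no room for a singleton and lowers the rank to exactly n - 1, which
  leaves one spare point on the other side as well; the singleton must be there. This is the shape
  of gamma or of its inverse.

  The obstacle is that identifications in a product can run in long chains alternating between the
  two factors. Products are therefore computed by labels only where one identification step
  suffices: when one factor's labelling survives unchanged, or when both factors are partial
  bijections. Closure of the semigroup and the rank bound concern arbitrary products and are argued
  on the generated equivalence itself.\<close>

section \<open>Labelled diagrams and the gluing of two factors\<close>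

definition lab :: "(nat \<Rightarrow> nat) \<Rightarrow> (nat \<Rightarrow> nat) \<Rightarrow> pt \<Rightarrow> nat" where
  "lab f g = (\<lambda>(i, t). if t = 0 then f i else g i)"

definition diagram_block :: "nat \<Rightarrow> (nat \<Rightarrow> nat) \<Rightarrow> (nat \<Rightarrow> nat) \<Rightarrow> pt \<Rightarrow> pt set" where
  "diagram_block n f g u = (if lab f g u = 0 then {u} else {v \<in> ground n. lab f g v = lab f g u})"

definition diagram :: "nat \<Rightarrow> (nat \<Rightarrow> nat) \<Rightarrow> (nat \<Rightarrow> nat) \<Rightarrow> bpart" where
  "diagram n f g = diagram_block n f g ` ground n"

text \<open>Equality of the nonzero label sets is what makes every nonzero class meet both X and X'.
  It also lets the rank be read off either labelling alone.\<close>

definition compat :: "nat \<Rightarrow> (nat \<Rightarrow> nat) \<Rightarrow> (nat \<Rightarrow> nat) \<Rightarrow> bool" where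
  "compat n f g \<longleftrightarrow> f ` {1..n} - {0} = g ` {1..n} - {0}"

text \<open>The pointwise forms of the two relabellings inside \<open>star\<close>:
  \<open>up\<close> places the left factor on X and X'', \<open>dn\<close> places the right factor
  on X'' and X'.\<close>

definition up :: "pt \<Rightarrow> pt" where "up = (\<lambda>(i, t). (i, if t = 1 then 2 else t))"
definition dn :: "pt \<Rightarrow> pt" where "dn = (\<lambda>(i, t). (i, if t = 0 then 2 else t))"

definition glued :: "bpart \<Rightarrow> bpart \<Rightarrow> bpart" where
  "glued \<alpha> \<beta> = image up ` \<alpha> \<union> image dn ` \<beta>"

definition sim :: "bpart \<Rightarrow> bpart \<Rightarrow> (pt \<times> pt) set" where
  "sim \<alpha> \<beta> = {(u, v). \<exists>C \<in> glued \<alpha> \<beta>. u \<in> C \<and> v \<in> C}\<^sup>*"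

definition good :: "bpart \<Rightarrow> bpart \<Rightarrow> pt \<Rightarrow> bool" where
  "good \<alpha> \<beta> u \<longleftrightarrow> \<not> (\<exists>w. {w} \<in> glued \<alpha> \<beta> \<and> (u, w) \<in> sim \<alpha> \<beta>)"

text \<open>The local names of \<open>star\<close> become constants that can be reasoned about; they
  are shaped so that unfolding makes both sides the same term.\<close>

lemma star_eq:
  "star n \<alpha> \<beta> =
    (\<lambda>u. if good \<alpha> \<beta> u then {v \<in> ground n. (u, v) \<in> sim \<alpha> \<beta>} else {u}) ` ground n"
  unfolding star_def relabel_def Let_def good_def sim_def glued_def up_def dn_def by (rule refl)

lemma ground_iff [simp]: "(i, t) \<in> ground n \<longleftrightarrow> i \<in> {1..n} \<and> (t = 0 \<or> t = 1)"
  by (auto simp: ground_def)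

lemma finite_ground: "finite (ground n)"
  by (rule finite_subset[of _ "{1..n} \<times> {0, 1}"]) (auto simp: ground_def)

lemma lab_simps [simp]: "lab f g (i, 0) = f i" "lab f g (i, Suc 0) = g i"
  by (auto simp: lab_def)

lemma up_simps [simp]: "up (i, 0) = (i, 0)" "up (i, Suc 0) = (i, 2)"
  and dn_simps [simp]: "dn (i, 0) = (i, 2)" "dn (i, Suc 0) = (i, Suc 0)"
  by (auto simp: up_def dn_def)

text \<open>Injectivity is restricted to \<open>ground n\<close>: a point already in copy 2 would
  collide with the image of the renamed copy.\<close>

lemma inj_up: "inj_on up (ground n)" and inj_dn: "inj_on dn (ground n)"
  by (auto simp: inj_on_def up_def dn_def ground_def split: if_splits)

section \<open>The generated equivalence and its classes containing singletons\<close>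

lemma sim_refl: "(u, u) \<in> sim \<alpha> \<beta>"
  by (simp add: sim_def)

lemma sim_trans: "(u, v) \<in> sim \<alpha> \<beta> \<Longrightarrow> (v, w) \<in> sim \<alpha> \<beta> \<Longrightarrow> (u, w) \<in> sim \<alpha> \<beta>"
  unfolding sim_def by (rule rtrancl_trans)

text \<open>The reflexive transitive closure used in \<open>star\<close> is already an equivalence,
  because lying in a common block is symmetric.\<close>

lemma sim_sym: "(u, v) \<in> sim \<alpha> \<beta> \<Longrightarrow> (v, u) \<in> sim \<alpha> \<beta>"
proof -
  have "sym (sim \<alpha> \<beta>)"
    unfolding sim_def by (rule sym_rtrancl) (auto simp: sym_def)
  then show "(u, v) \<in> sim \<alpha> \<beta> \<Longrightarrow> (v, u) \<in> sim \<alpha> \<beta>" by (rule symD)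
qed

lemma sim_up: "B \<in> \<alpha> \<Longrightarrow> p \<in> B \<Longrightarrow> q \<in> B \<Longrightarrow> (up p, up q) \<in> sim \<alpha> \<beta>"
  unfolding sim_def glued_def by (rule r_into_rtrancl) blast

lemma sim_dn: "B \<in> \<beta> \<Longrightarrow> p \<in> B \<Longrightarrow> q \<in> B \<Longrightarrow> (dn p, dn q) \<in> sim \<alpha> \<beta>"
  unfolding sim_def glued_def by (rule r_into_rtrancl) blast

lemma good_cong: "(u, v) \<in> sim \<alpha> \<beta> \<Longrightarrow> good \<alpha> \<beta> u \<longleftrightarrow> good \<alpha> \<beta> v"
  unfolding good_def by (meson sim_sym sim_trans)

lemma not_good_up: "{p} \<in> \<alpha> \<Longrightarrow> (u, up p) \<in> sim \<alpha> \<beta> \<Longrightarrow> \<not> good \<alpha> \<beta> u"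
proof -
  assume "{p} \<in> \<alpha>" and s: "(u, up p) \<in> sim \<alpha> \<beta>"
  then have "up ` {p} \<in> glued \<alpha> \<beta>" unfolding glued_def by (intro UnI1 imageI)
  then show "\<not> good \<alpha> \<beta> u" using s unfolding good_def image_insert image_empty by blast
qed

lemma not_good_dn: "{p} \<in> \<beta> \<Longrightarrow> (u, dn p) \<in> sim \<alpha> \<beta> \<Longrightarrow> \<not> good \<alpha> \<beta> u"
proof -
  assume "{p} \<in> \<beta>" and s: "(u, dn p) \<in> sim \<alpha> \<beta>"
  then have "dn ` {p} \<in> glued \<alpha> \<beta>" unfolding glued_def by (intro UnI2 imageI)
  then show "\<not> good \<alpha> \<beta> u" using s unfolding good_def image_insert image_empty by blast
qed

lemma image_eq_singleton:
  assumes "inj_on \<phi> S" "B \<subseteq> S" "\<phi> ` B = {w}"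
  shows "\<exists>p. B = {p} \<and> w = \<phi> p"
proof -
  have "B \<noteq> {}" using assms(3) by auto
  then obtain p where "p \<in> B" by auto
  moreover from this have "x = p" if "x \<in> B" for x
    using that assms by (metis imageI inj_onD singletonD subsetD)
  ultimately have "B = {p}" by blast
  then show ?thesis using assms(3) by auto
qed

text \<open>Injectivity of \<open>up\<close> and \<open>dn\<close> prevents larger blocks from
  shrinking, so singletons of the glued family come from singletons of the factors.\<close>

lemma singleton_glued:
  assumes "\<Union>\<alpha> \<subseteq> ground n" "\<Union>\<beta> \<subseteq> ground n" "{w} \<in> glued \<alpha> \<beta>"
  shows "\<exists>p. {p} \<in> \<alpha> \<and> w = up p \<or> {p} \<in> \<beta> \<and> w = dn p"
proof -
  consider B where "B \<in> \<alpha>" "up ` B = {w}" | B where "B \<in> \<beta>" "dn ` B = {w}"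
    using assms(3) unfolding glued_def by blast
  then show ?thesis
  proof cases
    case 1
    then show ?thesis using image_eq_singleton[OF inj_up[of n], of B w] assms(1) by blast
  next
    case 2
    then show ?thesis using image_eq_singleton[OF inj_dn[of n], of B w] assms(2) by blast
  qed
qed

text \<open>The means of showing that points are not identified: give them different values under a
  labelling of the three copies that is constant on every block.\<close>

lemma sim_invariant:
  assumes "\<And>B p p'. B \<in> \<alpha> \<Longrightarrow> p \<in> B \<Longrightarrow> p' \<in> B \<Longrightarrow> L (up p) = L (up p')"
    and "\<And>B p p'. B \<in> \<beta> \<Longrightarrow> p \<in> B \<Longrightarrow> p' \<in> B \<Longrightarrow> L (dn p) = L (dn p')"
    and "(u, v) \<in> sim \<alpha> \<beta>"
  shows "L u = L v"
  using assms(3) unfolding sim_def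
proof (induction rule: rtrancl_induct)
  case (step y z)
  then obtain C where C: "C \<in> glued \<alpha> \<beta>" "y \<in> C" "z \<in> C" by auto
  then have "L y = L z" using assms(1,2) unfolding glued_def by blast
  then show ?case using step by simp
qed simp

section \<open>Blocks of a diagram and renaming of labels\<close>

lemma diagram_block_self: "u \<in> ground n \<Longrightarrow> u \<in> diagram_block n f g u"
  by (simp add: diagram_block_def)

lemma diagram_block_eq: "w \<in> diagram_block n f g u \<Longrightarrow> diagram_block n f g w = diagram_block n f g u"
  by (cases "lab f g u = 0") (simp_all add: diagram_block_def)

lemma Union_diagram: "\<Union>(diagram n f g) = ground n"
proof
  show "\<Union>(diagram n f g) \<subseteq> ground n"
    unfolding diagram_def diagram_block_def by (rule Union_least) (auto split: if_splits)
  show "ground n \<subseteq> \<Union>(diagram n f g)"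
    unfolding diagram_def diagram_block_def by (rule subsetI, rule UnionI, erule imageI) simp
qed

lemma diagram_same_block:
  assumes "B \<in> diagram n f g" "p \<in> B" "q \<in> B"
  shows "lab f g p = lab f g q"
proof -
  obtain u where "B = (if lab f g u = 0 then {u} else {v \<in> ground n. lab f g v = lab f g u})"
    using assms(1) unfolding diagram_def diagram_block_def by blast
  then show ?thesis using assms(2,3) by (cases "lab f g u = 0") simp_all
qed

lemma diagram_zero: "p \<in> ground n \<Longrightarrow> lab f g p = 0 \<Longrightarrow> {p} \<in> diagram n f g"
  unfolding diagram_def diagram_block_def by (rule image_eqI[of _ _ p]) simp_all

lemma diagram_line:
  assumes "p \<in> ground n" "q \<in> ground n" "lab f g p = lab f g q" "lab f g p \<noteq> 0"
  shows "\<exists>B \<in> diagram n f g. p \<in> B \<and> q \<in> B"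
proof -
  have "{v \<in> ground n. lab f g v = lab f g p} \<in> diagram n f g"
    unfolding diagram_def diagram_block_def by (rule image_eqI[of _ _ p]) (use assms(1,4) in simp_all)
  then show ?thesis using assms(1-3) by (intro bexI) simp_all
qed

lemma compatD1: "compat n f g \<Longrightarrow> x \<in> {1..n} \<Longrightarrow> f x \<noteq> 0 \<Longrightarrow> \<exists>z\<in>{1..n}. g z = f x"
proof -
  assume "compat n f g" "x \<in> {1..n}" "f x \<noteq> 0"
  then have "f x \<in> f ` {1..n} - {0}" by simp
  then have "f x \<in> g ` {1..n} - {0}" using \<open>compat n f g\<close> by (simp only: compat_def)
  then show "\<exists>z\<in>{1..n}. g z = f x" by force
qed

lemma compat_sym: "compat n f g \<Longrightarrow> compat n g f"
  unfolding compat_def by simp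

lemma compatD2: "compat n f g \<Longrightarrow> x \<in> {1..n} \<Longrightarrow> g x \<noteq> 0 \<Longrightarrow> \<exists>z\<in>{1..n}. f z = g x"
  using compatD1 compat_sym by blast

lemma compatI:
  assumes "\<And>x. x \<in> {1..n} \<Longrightarrow> f x \<noteq> 0 \<Longrightarrow> \<exists>z\<in>{1..n}. g z = f x"
    and "\<And>x. x \<in> {1..n} \<Longrightarrow> g x \<noteq> 0 \<Longrightarrow> \<exists>z\<in>{1..n}. f z = g x"
  shows "compat n f g"
proof -
  have "f ` {1..n} - {0} \<subseteq> g ` {1..n} - {0}"
    if "\<And>x. x \<in> {1..n} \<Longrightarrow> f x \<noteq> 0 \<Longrightarrow> \<exists>z\<in>{1..n}. g z = f x" for f g :: "nat \<Rightarrow> nat"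
  proof
    fix l assume l: "l \<in> f ` {1..n} - {0}"
    then obtain x where "x \<in> {1..n}" "l = f x" by blast
    then show "l \<in> g ` {1..n} - {0}" using that[of x] l by force
  qed
  then show ?thesis using assms unfolding compat_def by (meson subset_antisym)
qed

text \<open>Here \<open>compat\<close> is essential: a nonzero label used on one side recurs on the
  other, so its class has at least two points.\<close>

lemma diagram_singleton:
  assumes "compat n f g" "{p} \<in> diagram n f g"
  shows "lab f g p = 0"
proof (rule ccontr)
  assume nz: "lab f g p \<noteq> 0"
  have pg: "p \<in> ground n" using Union_diagram[of n f g] assms(2) by blast
  obtain u where u: "{p} = diagram_block n f g u"
    using assms(2) unfolding diagram_def by blast
  then have "diagram_block n f g p = {p}" using diagram_block_eq by blast
  then have eq: "{v \<in> ground n. lab f g v = lab f g p} = {p}"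
    using nz by (simp add: diagram_block_def)
  obtain i t where p: "p = (i, t)" by force
  have i: "i \<in> {1..n}" and t: "t = 0 \<or> t = Suc 0" using pg p by auto
  have "\<exists>q \<in> ground n. lab f g q = lab f g p \<and> q \<noteq> p"
  proof (cases "t = 0")
    case True
    then obtain z where "z \<in> {1..n}" "g z = f i" using compatD1[OF assms(1) i] nz p by auto
    then show ?thesis using True p by (intro bexI[of _ "(z, Suc 0)"]) auto
  next
    case False
    then obtain z where "z \<in> {1..n}" "f z = g i" using compatD2[OF assms(1) i] nz p t by auto
    then show ?thesis using False t p by (intro bexI[of _ "(z, 0)"]) auto
  qed
  then show False using eq by blast
qed

lemma diagram_eqI:
  assumes "\<And>u. u \<in> ground n \<Longrightarrow> lab f g u = 0 \<longleftrightarrow> lab f' g' u = 0"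
    and "\<And>u v. u \<in> ground n \<Longrightarrow> v \<in> ground n \<Longrightarrow> lab f g u \<noteq> 0 \<Longrightarrow>
      lab f g v = lab f g u \<longleftrightarrow> lab f' g' v = lab f' g' u"
  shows "diagram n f g = diagram n f' g'"
  unfolding diagram_def diagram_block_def
proof (rule image_cong[OF refl])
  fix u assume u: "u \<in> ground n"
  have "{v \<in> ground n. lab f g v = lab f g u} = {v \<in> ground n. lab f' g' v = lab f' g' u}"
    if "lab f g u \<noteq> 0" using assms(2)[OF u _ that] by auto
  then show "(if lab f g u = 0 then {u} else {v \<in> ground n. lab f g v = lab f g u}) =
    (if lab f' g' u = 0 then {u} else {v \<in> ground n. lab f' g' v = lab f' g' u})"
    using assms(1)[OF u] by auto
qed

text \<open>Only equality and vanishing of labels matter to a diagram. Including 0 in the set where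
  \<open>p\<close> is injective keeps nonzero labels nonzero.\<close>

lemma diagram_relabel:
  assumes "\<And>i. i \<in> {1..n} \<Longrightarrow> f' i = p (f i)" "\<And>i. i \<in> {1..n} \<Longrightarrow> g' i = p (g i)"
    and "p 0 = 0" "inj_on p (insert 0 (f ` {1..n} \<union> g ` {1..n}))"
  shows "diagram n f' g' = diagram n f g"
proof -
  have l: "lab f' g' u = p (lab f g u)" if "u \<in> ground n" for u
    using that assms(1,2) by (cases u) auto
  have m: "lab f g u \<in> insert 0 (f ` {1..n} \<union> g ` {1..n})" if "u \<in> ground n" for u
    using that by (cases u) auto
  show ?thesis
  proof (rule diagram_eqI)
    fix u assume u: "u \<in> ground n"
    show "lab f' g' u = 0 \<longleftrightarrow> lab f g u = 0"
      using inj_on_eq_iff[OF assms(4) m[OF u], of 0] l[OF u] assms(3) by simp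
    fix v assume v: "v \<in> ground n"
    show "lab f' g' v = lab f' g' u \<longleftrightarrow> lab f g v = lab f g u"
      using inj_on_eq_iff[OF assms(4) m[OF v] m[OF u]] l u v by simp
  qed
qed

lemma diagram_cong:
  assumes "\<And>i. i \<in> {1..n} \<Longrightarrow> f' i = f i" "\<And>i. i \<in> {1..n} \<Longrightarrow> g' i = g i"
  shows "diagram n f' g' = diagram n f g"
  by (rule diagram_relabel[where p = "\<lambda>x. x"]) (use assms in auto)

section \<open>The product as a pushout of labellings\<close>

text \<open>The hypotheses say that q and r are a pushout of g and h along label 0; P1 and P0 replace
  chains of identifications by a single step, which suffices when g or h is absorbed by the other
  (q or r the identity) and for partial bijections.\<close>
lemma star_diagram:
  assumes c1: "compat n f g" and c2: "compat n h k"
    and q0: "q 0 = 0" and r0: "r 0 = 0"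
    and qr: "\<And>z. z \<in> {1..n} \<Longrightarrow> q (g z) = r (h z)"
    and P1: "\<And>y z. y \<in> {1..n} \<Longrightarrow> z \<in> {1..n} \<Longrightarrow> q (g y) = q (g z) \<Longrightarrow> q (g y) \<noteq> 0 \<Longrightarrow>
      g y = g z \<or> h y = h z"
    and P0: "\<And>y. y \<in> {1..n} \<Longrightarrow> q (g y) = 0 \<Longrightarrow> g y = 0 \<or> h y = 0"
  shows "star n (diagram n f g) (diagram n h k) = diagram n (q \<circ> f) (r \<circ> k)"
proof -
  let ?\<alpha> = "diagram n f g" and ?\<beta> = "diagram n h k"
  let ?sim = "sim ?\<alpha> ?\<beta>"
  \<comment> \<open>One labelling of all three copies. By \<open>qr\<close> the value on X'' can be
    read from either factor, so \<open>L\<close> is constant on the blocks of both.\<close>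
  define L :: "pt \<Rightarrow> nat" where
    "L = (\<lambda>(i, t). if t = 0 then q (f i) else if t = 1 then r (k i) else q (g i))"
  have L: "L (i, 0) = q (f i)" "L (i, Suc 0) = r (k i)" "L (i, 2) = q (g i)" for i
    by (auto simp: L_def)
  have Lup: "L (up p) = q (lab f g p)" if "p \<in> ground n" for p
    using that by (cases p) (auto simp: L)
  have Ldn: "L (dn p) = r (lab h k p)" if "p \<in> ground n" for p
    using that qr by (cases p) (auto simp: L)
  have mem: "p \<in> ground n" if "B \<in> diagram n f' g'" "p \<in> B" for p B f' g'
    using that Union_diagram by blast
  have sound: "L u = L v" if "(u, v) \<in> ?sim" for u v
    by (rule sim_invariant[OF _ _ that]) (metis Lup Ldn mem diagram_same_block)+
  \<comment> \<open>Singletons carry label 0 in their factor and \<open>q\<close>, \<open>r\<close>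
    preserve 0; with \<open>sound\<close>, any point identified with a singleton has
    \<open>L\<close>-value 0.\<close>
  have sing: "L w = 0" if "{w} \<in> glued ?\<alpha> ?\<beta>" for w
  proof -
    from singleton_glued[OF _ _ that, of n] obtain p where
      "{p} \<in> ?\<alpha> \<and> w = up p \<or> {p} \<in> ?\<beta> \<and> w = dn p" by (auto simp: Union_diagram)
    then show ?thesis
      using diagram_singleton[OF c1, of p] diagram_singleton[OF c2, of p] Lup Ldn mem q0 r0
      by (metis singletonI)
  qed
  have upl: "(up p, up p') \<in> ?sim"
    if "p \<in> ground n" "p' \<in> ground n" "lab f g p = lab f g p'" "lab f g p \<noteq> 0" for p p'
    using diagram_line[OF that] sim_up by blast
  have dnl: "(dn p, dn p') \<in> ?sim"
    if "p \<in> ground n" "p' \<in> ground n" "lab h k p = lab h k p'" "lab h k p \<noteq> 0" for p p'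
    using diagram_line[OF that] sim_dn by blast
  \<comment> \<open>By \<open>compat\<close>, the line through an outer point of nonzero
    \<open>L\<close>-value reaches the middle copy in one step. This reduces completeness to pairs
    of middle points.\<close>
  have mid: "\<exists>z\<in>{1..n}. (u, (z, 2)) \<in> ?sim" if u: "u \<in> ground n" and nz: "L u \<noteq> 0" for u
  proof -
    obtain i t where ut: "u = (i, t)" by force
    have i: "i \<in> {1..n}" and t: "t = 0 \<or> t = Suc 0" using u ut by auto
    from t show ?thesis
    proof
      assume t: "t = 0"
      then have nz': "f i \<noteq> 0" using nz ut L q0 by metis
      then obtain z where z: "z \<in> {1..n}" "g z = f i" using compatD1[OF c1 i] by auto
      then have "(up (i, 0), up (z, Suc 0)) \<in> ?sim" using upl[of "(i, 0)" "(z, Suc 0)"] nz' i z by simp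
      then show ?thesis using z ut t by auto
    next
      assume t: "t = Suc 0"
      then have nz': "k i \<noteq> 0" using nz ut L r0 by metis
      then obtain z where z: "z \<in> {1..n}" "h z = k i" using compatD2[OF c2 i] by auto
      then have "(dn (i, Suc 0), dn (z, 0)) \<in> ?sim" using dnl[of "(i, Suc 0)" "(z, 0)"] nz' i z by simp
      then show ?thesis using z ut t by auto
    qed
  qed
  have complete: "(u, v) \<in> ?sim"
    if u: "u \<in> ground n" and v: "v \<in> ground n" and nz: "L u \<noteq> 0" and e: "L v = L u" for u v
  proof -
    obtain y where y: "y \<in> {1..n}" "(u, (y, 2)) \<in> ?sim" using mid[OF u nz] by auto
    obtain z where z: "z \<in> {1..n}" "(v, (z, 2)) \<in> ?sim" using mid[OF v] nz e by auto
    have q: "q (g y) = L u" "q (g z) = L u" using sound[OF y(2)] sound[OF z(2)] e L by simp_all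
    then have nz2: "g y \<noteq> 0" "h y \<noteq> 0" using nz q0 r0 qr[OF y(1)] by metis+
    \<comment> \<open>\<open>P1\<close> provides a common label in one of the factors; that label is
      nonzero, so the two middle points lie on one line there.\<close>
    have "((y, 2), (z, 2)) \<in> ?sim"
      using P1[OF y(1) z(1)] q nz nz2 upl[of "(y, Suc 0)" "(z, Suc 0)"] dnl[of "(y, 0)" "(z, 0)"]
        y(1) z(1) by auto
    then show ?thesis using y z sim_trans sim_sym by blast
  qed
  \<comment> \<open>Either the point is itself a singleton of its factor, or its line reaches a
    middle point which, by \<open>P0\<close>, is a singleton of the other factor.\<close>
  have bad: "\<not> good ?\<alpha> ?\<beta> u" if u: "u \<in> ground n" and zero: "L u = 0" for u
  proof -
    obtain i t where ut: "u = (i, t)" by force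
    have i: "i \<in> {1..n}" and t: "t = 0 \<or> t = Suc 0" using u ut by auto
    from t show ?thesis
    proof
      assume t: "t = 0"
      show ?thesis
      proof (cases "f i = 0")
        case True
        have "{(i, 0)} \<in> ?\<alpha>" by (rule diagram_zero) (use i True in auto)
        then show ?thesis using not_good_up[of "(i, 0)" ?\<alpha> u] sim_refl t ut by simp
      next
        case False
        then obtain z where z: "z \<in> {1..n}" "g z = f i" using compatD1[OF c1 i] by auto
        then have s: "(up (i, 0), up (z, Suc 0)) \<in> ?sim" using upl[of "(i, 0)" "(z, Suc 0)"] False i z by simp
        have "h z = 0" using P0[OF z(1)] z(2) False zero L ut t by auto
        then have "{(z, 0)} \<in> ?\<beta>" by (intro diagram_zero) (use z in auto)
        then show ?thesis using not_good_dn[of "(z, 0)" ?\<beta> u] s t ut by simp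
      qed
    next
      assume t: "t = Suc 0"
      show ?thesis
      proof (cases "k i = 0")
        case True
        have "{(i, Suc 0)} \<in> ?\<beta>" by (rule diagram_zero) (use i True in auto)
        then show ?thesis using not_good_dn[of "(i, Suc 0)" ?\<beta> u] sim_refl t ut by simp
      next
        case False
        then obtain z where z: "z \<in> {1..n}" "h z = k i" using compatD2[OF c2 i] by auto
        then have s: "(dn (i, Suc 0), dn (z, 0)) \<in> ?sim" using dnl[of "(i, Suc 0)" "(z, 0)"] False i z by simp
        have "g z = 0" using P0[OF z(1)] z(2) False zero L ut t qr[OF z(1)] by auto
        then have "{(z, Suc 0)} \<in> ?\<alpha>" by (intro diagram_zero) (use z in auto)
        then show ?thesis using not_good_up[of "(z, Suc 0)" ?\<alpha> u] s t ut by simp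
      qed
    qed
  qed
  have good: "good ?\<alpha> ?\<beta> u \<longleftrightarrow> L u \<noteq> 0" if "u \<in> ground n" for u
    using bad[OF that] sound sing unfolding good_def by metis
  have Llab: "lab (q \<circ> f) (r \<circ> k) u = L u" if "u \<in> ground n" for u
    using that by (cases u) (auto simp: L)
  show ?thesis
    unfolding star_eq diagram_def[of n "q \<circ> f" "r \<circ> k"] diagram_block_def
  proof (rule image_cong[OF refl])
    fix u assume u: "u \<in> ground n"
    have "{v \<in> ground n. (u, v) \<in> ?sim} =
        {v \<in> ground n. lab (q \<circ> f) (r \<circ> k) v = lab (q \<circ> f) (r \<circ> k) u}" if "L u \<noteq> 0"
    proof (rule Collect_cong, rule conj_cong[OF refl])
      fix v assume v: "v \<in> ground n"
      show "(u, v) \<in> ?sim \<longleftrightarrow> lab (q \<circ> f) (r \<circ> k) v = lab (q \<circ> f) (r \<circ> k) u"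
        using complete[OF u v that] sound[of u v] Llab[OF u] Llab[OF v] by argo
    qed
    then show "(if good ?\<alpha> ?\<beta> u then {v \<in> ground n. (u, v) \<in> ?sim} else {u}) =
      (if lab (q \<circ> f) (r \<circ> k) u = 0 then {u}
       else {v \<in> ground n. lab (q \<circ> f) (r \<circ> k) v = lab (q \<circ> f) (r \<circ> k) u})"
      using good[OF u] Llab[OF u] by auto
  qed
qed


section \<open>Diagrams are exactly the elements of the semigroup\<close>

text \<open>If two blocks share a point w, both equal \<open>c w\<close>. Diagrams and products are
  each given by such a block-valued map, so both use this.\<close>

lemma is_partition_image:
  assumes "\<And>u. u \<in> G \<Longrightarrow> u \<in> c u" "\<And>u. u \<in> G \<Longrightarrow> c u \<subseteq> G"
    and eq: "\<And>u w. u \<in> G \<Longrightarrow> w \<in> c u \<Longrightarrow> c w = c u"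
  shows "is_partition G (c ` G)"
  unfolding is_partition_def
proof (intro conjI ballI impI)
  fix B assume "B \<in> c ` G"
  then obtain u where u: "u \<in> G" "B = c u" by blast
  then show "B \<noteq> {}" "B \<subseteq> G" using assms by blast+
  fix C assume "C \<in> c ` G" and ne: "B \<noteq> C"
  then obtain v where v: "v \<in> G" "C = c v" by blast
  show "B \<inter> C = {}"
  proof (rule ccontr)
    assume "B \<inter> C \<noteq> {}"
    then obtain w where "w \<in> c u" "w \<in> c v" using u v by blast
    then show False using eq[OF u(1)] eq[OF v(1)] ne u v by metis
  qed
next
  show "\<Union>(c ` G) = G" using assms(1,2) by blast
qed

lemma diagram_in_PIstar:
  assumes c: "compat n f g"
  shows "diagram n f g \<in> PIstar n"
proof -
  have "is_partition (ground n) (diagram n f g)"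
    unfolding diagram_def
    by (rule is_partition_image) (use diagram_block_self diagram_block_eq in \<open>auto simp: diagram_block_def split: if_splits\<close>)
  moreover have "(\<exists>x. B = {x}) \<or> (B \<inter> Xs n \<noteq> {} \<and> B \<inter> Xp n \<noteq> {})" if B: "B \<in> diagram n f g" for B
  proof -
    obtain u where u: "u \<in> ground n" "B = diagram_block n f g u" using B unfolding diagram_def by blast
    show ?thesis
    proof (cases "lab f g u = 0")
      case True
      then show ?thesis using u by (simp add: diagram_block_def)
    next
      case nz: False
      obtain i t where ut: "u = (i, t)" by force
      have i: "i \<in> {1..n}" and t: "t = 0 \<or> t = Suc 0" using u ut by auto
      have "\<exists>x\<in>{1..n}. \<exists>y\<in>{1..n}. f x = lab f g u \<and> g y = lab f g u"
      proof (cases "t = 0")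
        case True
        then show ?thesis using compatD1[OF c i] i ut nz by (metis lab_simps(1))
      next
        case False
        then show ?thesis using compatD2[OF c i] i t ut nz by (metis lab_simps(2))
      qed
      then obtain x y where "x \<in> {1..n}" "y \<in> {1..n}" "f x = lab f g u" "g y = lab f g u" by blast
      then have "(x, 0) \<in> B \<inter> Xs n" "(y, Suc 0) \<in> B \<inter> Xp n"
        using u nz by (simp_all add: Xs_def Xp_def diagram_block_def)
      then show ?thesis by blast
    qed
  qed
  ultimately show ?thesis unfolding PIstar_def by blast
qed

lemma PIstar_part: "\<alpha> \<in> PIstar n \<Longrightarrow> is_partition (ground n) \<alpha>"
  by (simp add: PIstar_def)

lemma PIstar_Union: "\<alpha> \<in> PIstar n \<Longrightarrow> \<Union>\<alpha> = ground n"
  using PIstar_part unfolding is_partition_def by simp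

lemma PIstar_unique:
  "\<alpha> \<in> PIstar n \<Longrightarrow> B \<in> \<alpha> \<Longrightarrow> C \<in> \<alpha> \<Longrightarrow> p \<in> B \<Longrightarrow> p \<in> C \<Longrightarrow> B = C"
  using PIstar_part unfolding is_partition_def by blast

lemma PIstar_line:
  assumes "\<alpha> \<in> PIstar n" "B \<in> \<alpha>" "\<nexists>x. B = {x}"
  shows "\<exists>x\<in>{1..n}. (x, 0) \<in> B" "\<exists>x\<in>{1..n}. (x, Suc 0) \<in> B"
  using assms unfolding PIstar_def Xs_def Xp_def by fastforce+

text \<open>A line is labelled by its least element of X. This is positive because coordinates start
  at 1, and it determines the line because it lies on it.\<close>

lemma PIstar_obtains_diagram:
  assumes \<alpha>: "\<alpha> \<in> PIstar n"
  obtains f g where "compat n f g" "\<alpha> = diagram n f g"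
proof -
  define m where "m B = (LEAST i. (i, 0) \<in> B)" for B :: "pt set"
  define blk where "blk p = (THE B. B \<in> \<alpha> \<and> p \<in> B)" for p
  define l where "l p = (if {p} \<in> \<alpha> then 0 else m (blk p))" for p
  define f where "f i = l (i, 0)" for i
  define g where "g i = l (i, Suc 0)" for i
  have blk: "blk p = B" if "B \<in> \<alpha>" "p \<in> B" for p B
    unfolding blk_def by (rule the_equality) (use that PIstar_unique[OF \<alpha>] in blast)+
  have blk_in: "blk p \<in> \<alpha> \<and> p \<in> blk p" if "p \<in> ground n" for p
    using that PIstar_Union[OF \<alpha>] blk by (metis UnionE)
  have sub: "B \<subseteq> ground n" if "B \<in> \<alpha>" for B using that PIstar_Union[OF \<alpha>] by blast
  have m: "(m B, 0) \<in> B" "m B \<noteq> 0" if B: "B \<in> \<alpha>" "\<nexists>x. B = {x}" for B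
  proof -
    obtain x where "(x, 0) \<in> B" using PIstar_line[OF \<alpha> B] by blast
    then show mB: "(m B, 0) \<in> B" unfolding m_def by (rule LeastI)
    show "m B \<noteq> 0" using sub[OF B(1)] mB by (auto dest: subsetD)
  qed
  have lab: "lab f g p = l p" if "p \<in> ground n" for p
    using that by (cases p) (auto simp: f_def g_def)
  have l_blk: "l p = m B" if "B \<in> \<alpha>" "p \<in> B" "\<nexists>x. B = {x}" for p B
  proof -
    have "{p} \<notin> \<alpha>" using that PIstar_unique[OF \<alpha>, of "{p}" B p] by blast
    then show ?thesis using that blk by (simp add: l_def)
  qed
  have block: "(if lab f g u = 0 then {u} else {v \<in> ground n. lab f g v = lab f g u}) = blk u"
    if u: "u \<in> ground n" for u
  proof (cases "\<exists>x. blk u = {x}")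
    case True
    then have "blk u = {u}" using blk_in[OF u] by auto
    then show ?thesis using blk_in[OF u] lab[OF u] by (simp add: l_def)
  next
    case False
    note B = blk_in[OF u]
    have lu: "lab f g u = m (blk u)" using l_blk B False lab[OF u] by auto
    have "lab f g v = lab f g u \<longleftrightarrow> v \<in> blk u" if v: "v \<in> ground n" for v
    proof
      assume "v \<in> blk u"
      then show "lab f g v = lab f g u" using l_blk B False lab[OF v] lu by auto
    next
      assume e: "lab f g v = lab f g u"
      then have "l v \<noteq> 0" "l v = m (blk u)" using m(2) B False lu lab[OF v] by auto
      then have nv: "\<nexists>x. blk v = {x}" "l v = m (blk v)"
        using blk_in[OF v] by (auto simp: l_def split: if_splits)
      \<comment> \<open>Equal labels mean that the same least point of X lies in both blocks, so the
        blocks coincide.\<close>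
      have "(m (blk u), 0) \<in> blk v" using m(1)[OF _ nv(1)] blk_in[OF v] nv(2) \<open>l v = m (blk u)\<close> by auto
      moreover have "(m (blk u), 0) \<in> blk u" using m(1) B False by auto
      ultimately show "v \<in> blk u" using PIstar_unique[OF \<alpha>] B blk_in[OF v] by blast
    qed
    then show ?thesis using lu m(2)[OF _ False] B sub[of "blk u"] by auto
  qed
  have "diagram n f g = blk ` ground n"
    unfolding diagram_def diagram_block_def by (rule image_cong[OF refl]) (rule block)
  also have "\<dots> = \<alpha>"
  proof
    show "blk ` ground n \<subseteq> \<alpha>" using blk_in by blast
    show "\<alpha> \<subseteq> blk ` ground n"
    proof
      fix B assume B: "B \<in> \<alpha>"
      then have "B \<noteq> {}" using PIstar_part[OF \<alpha>] unfolding is_partition_def by simp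
      then obtain p where "p \<in> B" by blast
      then show "B \<in> blk ` ground n"
        using blk[OF B] sub[OF B] by (intro image_eqI[of _ _ p]) auto
    qed
  qed
  finally have eq: "\<alpha> = diagram n f g" by simp
  have nz: "\<nexists>x. blk p = {x}" if "p \<in> ground n" "l p \<noteq> 0" for p
    using that blk_in[OF that(1)] by (auto simp: l_def split: if_splits)
  have "compat n f g"
  proof (rule compatI)
    fix x assume x: "x \<in> {1..n}" "f x \<noteq> 0"
    let ?p = "(x, 0::nat)"
    have p: "?p \<in> ground n" using x by simp
    have B: "blk ?p \<in> \<alpha>" "\<nexists>x. blk ?p = {x}" using blk_in[OF p] nz[OF p] x by (auto simp: f_def)
    obtain y where "y \<in> {1..n}" "(y, Suc 0) \<in> blk ?p" using PIstar_line(2)[OF \<alpha> B] by blast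
    then show "\<exists>z\<in>{1..n}. g z = f x"
      using l_blk[OF B(1) _ B(2)] blk_in[OF p] by (intro bexI[of _ y]) (auto simp: f_def g_def)
  next
    fix x assume x: "x \<in> {1..n}" "g x \<noteq> 0"
    let ?p = "(x, Suc 0)"
    have p: "?p \<in> ground n" using x by simp
    have B: "blk ?p \<in> \<alpha>" "\<nexists>x. blk ?p = {x}" using blk_in[OF p] nz[OF p] x by (auto simp: g_def)
    obtain y where "y \<in> {1..n}" "(y, 0) \<in> blk ?p" using PIstar_line(1)[OF \<alpha> B] by blast
    then show "\<exists>z\<in>{1..n}. f z = g x"
      using l_blk[OF B(1) _ B(2)] blk_in[OF p] by (intro bexI[of _ y]) (auto simp: f_def g_def)
  qed
  then show thesis using eq that by blast
qed

lemma pinv_diagram: "pinv (diagram n f g) = diagram n g f"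
proof -
  \<comment> \<open>The point map underlying \<open>pinv\<close>: an involution of
    \<open>ground n\<close> that exchanges the two labellings.\<close>
  define sw :: "pt \<Rightarrow> pt" where "sw = (\<lambda>(i, t). (i, if t = 0 then 1 else if t = 1 then 0 else t))"
  have sw: "sw u \<in> ground n" "sw (sw u) = u" "lab g f (sw u) = lab f g u" if "u \<in> ground n" for u
    using that by (cases u; auto simp: sw_def)+
  have swg: "sw ` ground n = ground n"
    using sw(1,2) by (metis image_eqI image_subsetI subsetI subset_antisym)
  have blk: "sw ` (if lab f g u = 0 then {u} else {v \<in> ground n. lab f g v = lab f g u}) =
      (if lab g f (sw u) = 0 then {sw u} else {v \<in> ground n. lab g f v = lab g f (sw u)})"
    if u: "u \<in> ground n" for u
  proof -
    have "sw ` {v \<in> ground n. lab f g v = lab f g u} = {v \<in> ground n. lab g f v = lab g f (sw u)}"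
    proof
      show "sw ` {v \<in> ground n. lab f g v = lab f g u} \<subseteq> {v \<in> ground n. lab g f v = lab g f (sw u)}"
        using sw u by (intro image_subsetI) simp
      show "{v \<in> ground n. lab g f v = lab g f (sw u)} \<subseteq> sw ` {v \<in> ground n. lab f g v = lab f g u}"
      proof
        fix v assume "v \<in> {v \<in> ground n. lab g f v = lab g f (sw u)}"
        then have v: "v \<in> ground n" "lab g f v = lab g f (sw u)" by auto
        have "lab f g (sw v) = lab f g u" using sw(3)[OF sw(1)[OF v(1)]] sw v u by simp
        then show "v \<in> sw ` {v \<in> ground n. lab f g v = lab f g u}"
          using sw v by (intro image_eqI[of _ _ "sw v"]) simp_all
      qed
    qed
    then show ?thesis using sw(3)[OF u] by simp
  qed
  have "pinv (diagram n f g) =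
      (\<lambda>u. sw ` (if lab f g u = 0 then {u} else {v \<in> ground n. lab f g v = lab f g u})) ` ground n"
    unfolding pinv_def relabel_def diagram_def diagram_block_def sw_def[symmetric] image_image ..
  also have "\<dots> = (\<lambda>u. if lab g f u = 0 then {u} else {v \<in> ground n. lab g f v = lab g f u}) `
      (sw ` ground n)"
    unfolding image_image by (rule image_cong[OF refl]) (rule blk)
  finally show ?thesis unfolding swg diagram_def diagram_block_def .
qed

section \<open>Permutations as diagrams\<close>

lemma compat_perm: "bij_betw \<pi> {1..n} {1..n} \<Longrightarrow> compat n \<pi> id"
  by (simp add: compat_def bij_betw_def)

text \<open>Labelling each y' by y itself forces x to carry the label \<pi> x.\<close>

lemma perm_diagram:
  assumes \<pi>: "bij_betw \<pi> {1..n} {1..n}"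
  shows "(\<lambda>x. {(x, 0), (\<pi> x, 1)}) ` {1..n} = diagram n \<pi> id"
proof -
  have im: "\<pi> x \<in> {1..n}" if "x \<in> {1..n}" for x using \<pi> that by (rule bij_betw_apply)
  have diagram_block: "{v \<in> ground n. lab \<pi> id v = \<pi> x} = {(x, 0), (\<pi> x, 1)}" if x: "x \<in> {1..n}" for x
  proof (rule set_eqI)
    fix v :: pt
    obtain i t where v: "v = (i, t)" by force
    show "v \<in> {v \<in> ground n. lab \<pi> id v = \<pi> x} \<longleftrightarrow> v \<in> {(x, 0), (\<pi> x, 1)}"
      using im[OF x] x inj_onD[OF bij_betw_imp_inj_on[OF \<pi>], of i x] unfolding v by auto
  qed
  have nz: "lab \<pi> id u \<noteq> 0" if "u \<in> ground n" for u
    using that im by (cases u) fastforce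
  have "diagram n \<pi> id = (\<lambda>u. {v \<in> ground n. lab \<pi> id v = lab \<pi> id u}) ` ground n"
    unfolding diagram_def diagram_block_def by (rule image_cong[OF refl]) (simp add: nz)
  also have "\<dots> = (\<lambda>l. {v \<in> ground n. lab \<pi> id v = l}) ` (lab \<pi> id ` ground n)"
    by (simp add: image_image)
  also have "lab \<pi> id ` ground n = \<pi> ` {1..n}"
  proof
    show "lab \<pi> id ` ground n \<subseteq> \<pi> ` {1..n}"
    proof (rule image_subsetI)
      fix u assume "u \<in> ground n"
      then show "lab \<pi> id u \<in> \<pi> ` {1..n}"
        using bij_betw_imp_surj_on[OF \<pi>] by (cases u) auto
    qed
    show "\<pi> ` {1..n} \<subseteq> lab \<pi> id ` ground n"
      by (rule image_subsetI, rule image_eqI[of _ _ "(_, 0)"]) auto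
  qed
  finally have "diagram n \<pi> id = (\<lambda>x. {v \<in> ground n. lab \<pi> id v = \<pi> x}) ` {1..n}"
    by (simp only: image_image)
  also have "\<dots> = (\<lambda>x. {(x, 0), (\<pi> x, 1)}) ` {1..n}"
    by (rule image_cong[OF refl]) (rule diagram_block)
  finally show ?thesis by simp
qed

lemma Sym_eq: "Sym n = {diagram n \<pi> id | \<pi>. bij_betw \<pi> {1..n} {1..n}}"
proof (unfold Sym_def, rule Collect_cong, rule ex_cong1)
  show "bij_betw \<pi> {1..n} {1..n} \<and> P = (\<lambda>x. {(x, 0), (\<pi> x, 1)}) ` {1..n} \<longleftrightarrow>
    P = diagram n \<pi> id \<and> bij_betw \<pi> {1..n} {1..n}" for P \<pi>
    using perm_diagram[of \<pi> n] by argo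
qed

lemma Sym_diagramI: "bij_betw \<pi> {1..n} {1..n} \<Longrightarrow> diagram n \<pi> id \<in> Sym n"
  unfolding Sym_eq by blast

text \<open>\<open>bij_betw\<close> leaves the value at 0 arbitrary, whereas a renaming of labels
  must fix 0; hence the update at 0, which recurs below.\<close>

lemma inj_on_perm_zero:
  fixes \<rho> :: "nat \<Rightarrow> nat"
  assumes \<rho>: "bij_betw \<rho> {1..n} {1..n}"
  shows "inj_on (\<rho>(0 := 0)) (insert 0 {1..n})"
proof -
  have "inj_on (\<rho>(0 := 0)) {1..n}"
    using bij_betw_imp_inj_on[OF \<rho>] by (rule inj_on_cong[THEN iffD1, rotated]) auto
  moreover
  have "(\<rho>(0 := 0)) x \<noteq> 0" if "x \<in> {1..n}" for x
    using bij_betw_apply[OF \<rho> that] that by auto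
  then have "0 \<notin> \<rho>(0 := 0) ` {1..n}" by fastforce
  ultimately show ?thesis by simp
qed

text \<open>Renaming labels by \<pi> moves the permutation to the other side, where it appears
  inverted. The form with \<pi> first suits multiplication from the left, the other form
  multiplication from the right.\<close>

lemma diagram_perm_id:
  assumes \<pi>: "bij_betw \<pi> {1..n} {1..n}"
  shows "diagram n \<pi> id = diagram n id (the_inv_into {1..n} \<pi>)"
proof (rule diagram_relabel[where p = "\<pi>(0 := 0)"])
  let ?i = "the_inv_into {1..n} \<pi>"
  have i: "bij_betw ?i {1..n} {1..n}" using \<pi> by (rule bij_betw_the_inv_into)
  fix x assume x: "x \<in> {1..n}"
  have "?i x \<in> {1..n}" using i x by (rule bij_betw_apply)
  moreover have "\<pi> (?i x) = x" using f_the_inv_into_f_bij_betw[OF \<pi>] x by blast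
  ultimately show "id x = (\<pi>(0 := 0)) (?i x)" by auto
  show "\<pi> x = (\<pi>(0 := 0)) (id x)" using x by auto
next
  have "the_inv_into {1..n} \<pi> ` {1..n} = {1..n}"
    using bij_betw_the_inv_into[OF \<pi>] by (rule bij_betw_imp_surj_on)
  then show "inj_on (\<pi>(0 := 0)) (insert 0 (id ` {1..n} \<union> the_inv_into {1..n} \<pi> ` {1..n}))"
    using inj_on_perm_zero[OF \<pi>] by simp
qed simp

lemma diagram_id_perm:
  assumes "bij_betw \<rho> {1..n} {1..n}"
  shows "diagram n id \<rho> = diagram n (the_inv_into {1..n} \<rho>) id"
  using arg_cong[OF diagram_perm_id[OF assms], of pinv] by (simp add: pinv_diagram)

lemma Sym_diagramI': "bij_betw \<rho> {1..n} {1..n} \<Longrightarrow> diagram n id \<rho> \<in> Sym n"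
  by (simp add: diagram_id_perm Sym_diagramI bij_betw_the_inv_into)

lemma star_perm_left:
  assumes \<pi>: "bij_betw \<pi> {1..n} {1..n}" and c: "compat n f g"
  shows "star n (diagram n \<pi> id) (diagram n f g) = diagram n (f \<circ> \<pi>) g"
proof -
  \<comment> \<open>The pushout has \<open>r = id\<close>: the labelling of the second factor
    survives, and all identifications in the middle copy already occur in that factor.\<close>
  have "star n (diagram n \<pi> id) (diagram n f g) = diagram n (f(0 := 0) \<circ> \<pi>) (id \<circ> g)"
    by (rule star_diagram[OF compat_perm[OF \<pi>] c]) auto
  also have "\<dots> = diagram n (f \<circ> \<pi>) g"
    by (rule diagram_cong) (use bij_betw_apply[OF \<pi>] in fastforce)+
  finally show ?thesis .
qed

lemma star_perm_right:
  assumes \<rho>: "bij_betw \<rho> {1..n} {1..n}" and c: "compat n f g"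
  shows "star n (diagram n f g) (diagram n id \<rho>) = diagram n f (g \<circ> \<rho>)"
proof -
  have "star n (diagram n f g) (diagram n id \<rho>) = diagram n (id \<circ> f) (g(0 := 0) \<circ> \<rho>)"
    by (rule star_diagram[OF c compat_sym[OF compat_perm[OF \<rho>]]]) auto
  also have "\<dots> = diagram n f (g \<circ> \<rho>)"
    by (rule diagram_cong) (use bij_betw_apply[OF \<rho>] in fastforce)+
  finally show ?thesis .
qed

section \<open>The element gamma, its conjugates, and permutations with prescribed values\<close>

lemma gamma12_diagram:
  assumes "n \<ge> 2"
  shows "gamma12 n = diagram n (id(2 := 1)) (id(2 := 0))"
proof -
  let ?l = "lab (id(2 := 1)) (id(2 := 0)) :: pt \<Rightarrow> nat"
  let ?b = "\<lambda>u. if ?l u = 0 then {u} else {v \<in> ground n. ?l v = ?l u}"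
  have b1: "{v \<in> ground n. ?l v = 1} = {(1, 0), (2, 0), (1, 1)}"
    using assms by (auto simp: ground_def split: if_splits)
  have bt: "{v \<in> ground n. ?l v = t} = {(t, 0), (t, 1)}" if "t \<in> {3..n}" for t
    using that by (auto simp: ground_def split: if_splits)
  have v: "?b (1, 0) = {(1, 0), (2, 0), (1, 1)}" "?b (2, 0) = {(1, 0), (2, 0), (1, 1)}"
    "?b (1, 1) = {(1, 0), (2, 0), (1, 1)}" "?b (2, 1) = {(2, 1)}"
    using b1 by simp_all
  have w: "?b (t, 0) = {(t, 0), (t, 1)}" "?b (t, 1) = {(t, 0), (t, 1)}" if "t \<in> {3..n}" for t
    using bt[OF that] that by simp_all
  have "{1..n} = {1, 2} \<union> {3..n}" using assms by auto
  then have g: "ground n = {(1, 0), (2, 0), (1, 1), (2, 1)} \<union>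
      ((\<lambda>t. (t, 0)) ` {3..n} \<union> (\<lambda>t. (t, 1)) ` {3..n})"
    unfolding ground_def by auto
  have "diagram n (id(2 := 1)) (id(2 := 0)) = {?b (1, 0), ?b (2, 0), ?b (1, 1), ?b (2, 1)} \<union>
      ((\<lambda>t. ?b (t, 0)) ` {3..n} \<union> (\<lambda>t. ?b (t, 1)) ` {3..n})"
    unfolding diagram_def diagram_block_def by (subst g) (simp only: image_Un image_insert image_empty image_image)
  also have "(\<lambda>t. ?b (t, 0)) ` {3..n} = (\<lambda>t. {(t, 0), (t, 1)}) ` {3..n}"
    by (rule image_cong[OF refl]) (rule w)
  also have "(\<lambda>t. ?b (t, 1)) ` {3..n} = (\<lambda>t. {(t, 0), (t, 1)}) ` {3..n}"
    by (rule image_cong[OF refl]) (rule w)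
  finally have "diagram n (id(2 := 1)) (id(2 := 0)) =
    {?b (1, 0), ?b (2, 0), ?b (1, 1), ?b (2, 1)} \<union>
      ((\<lambda>t. {(t, 0), (t, 1)}) ` {3..n} \<union> (\<lambda>t. {(t, 0), (t, 1)}) ` {3..n})" .
  also have "\<dots> = gamma12 n" unfolding v gamma12_def Un_absorb insert_absorb2 ..
  finally show ?thesis ..
qed

text \<open>For a = 1 and b = 2 these labellings give \<open>gamma12\<close>; for other pairs they
  give its conjugate by a permutation sending a, b to 1, 2. On both sides the nonzero labels are
  those of {1..n} except b.\<close>

lemma compat_collapse: "a \<in> {1..n} \<Longrightarrow> b \<in> {1..n} \<Longrightarrow> a \<noteq> b \<Longrightarrow> compat n (id(b := a)) (id(b := 0))"
  unfolding compat_def by (auto simp: image_iff split: if_splits)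

text \<open>Both functions take the same nonzero values, each once, so matching values gives a
  bijection between their supports. The complements have equal size and are matched
  arbitrarily.\<close>

lemma exists_perm:
  assumes c: "compat n f g"
    and f: "inj_on f {x \<in> {1..n}. f x \<noteq> 0}" and g: "inj_on g {x \<in> {1..n}. g x \<noteq> 0}"
  shows "\<exists>\<rho>. bij_betw \<rho> {1..n} {1..n} \<and> (\<forall>y\<in>{1..n}. f (\<rho> y) = g y)"
proof -
  let ?F = "{x \<in> {1..n}. f x \<noteq> 0}" and ?G = "{x \<in> {1..n}. g x \<noteq> 0}"
  have "f ` ?F = f ` {1..n} - {0}" "g ` ?G = g ` {1..n} - {0}" by auto
  then have im: "f ` ?F = g ` ?G" using c by (simp add: compat_def)
  have fb: "bij_betw f ?F (g ` ?G)" using f im by (simp add: bij_betw_def)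
  have gb: "bij_betw g ?G (g ` ?G)" using g by (simp add: bij_betw_def)
  define \<sigma> where "\<sigma> = the_inv_into ?F f \<circ> g"
  have \<sigma>: "bij_betw \<sigma> ?G ?F"
    unfolding \<sigma>_def by (rule bij_betw_trans[OF gb bij_betw_the_inv_into[OF fb]])
  have f\<sigma>: "f (\<sigma> y) = g y" if "y \<in> ?G" for y
    unfolding \<sigma>_def using f_the_inv_into_f_bij_betw[OF fb, of "g y"] that by auto
  have "card ({1..n} - ?G) = card ({1..n} - ?F)"
    using bij_betw_same_card[OF \<sigma>] card_Diff_subset[of ?F "{1..n}"] card_Diff_subset[of ?G "{1..n}"]
    by force
  then have "\<exists>\<tau>. bij_betw \<tau> ({1..n} - ?G) ({1..n} - ?F)"
    by (intro finite_same_card_bij) simp_all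
  then obtain \<tau> where \<tau>: "bij_betw \<tau> ({1..n} - ?G) ({1..n} - ?F)" ..
  define \<rho> where "\<rho> x = (if x \<in> ?G then \<sigma> x else \<tau> x)" for x
  have "bij_betw \<rho> ?G ?F"
    using \<sigma> by (rule bij_betw_cong[THEN iffD1, rotated]) (simp add: \<rho>_def)
  moreover have "bij_betw \<rho> ({1..n} - ?G) ({1..n} - ?F)"
    using \<tau> by (rule bij_betw_cong[THEN iffD1, rotated]) (auto simp: \<rho>_def)
  ultimately have "bij_betw \<rho> (?G \<union> ({1..n} - ?G)) (?F \<union> ({1..n} - ?F))"
    by (rule bij_betw_combine) auto
  moreover have "?G \<union> ({1..n} - ?G) = {1..n}" "?F \<union> ({1..n} - ?F) = {1..n}" by auto
  ultimately have b: "bij_betw \<rho> {1..n} {1..n}" by simp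
  have "f (\<rho> y) = g y" if y: "y \<in> {1..n}" for y
  proof (cases "y \<in> ?G")
    case True
    then show ?thesis using f\<sigma> by (simp add: \<rho>_def)
  next
    case False
    then have "\<rho> y \<in> {1..n} - ?F" using bij_betw_apply[OF \<tau>, of y] y by (simp add: \<rho>_def)
    then show ?thesis using False y by auto
  qed
  then show ?thesis using b by blast
qed

lemma inj_on_two:
  "inj_on (\<lambda>x. if x = a then 1 else if x = b then 2 else 0 :: nat)
    {x \<in> S. (if x = a then 1 else if x = b then 2 else 0 :: nat) \<noteq> 0}"
proof (rule inj_onI, elim CollectE conjE)
  fix x y
  assume x: "(if x = a then 1 else if x = b then 2 else 0 :: nat) \<noteq> 0"
   and y: "(if y = a then 1 else if y = b then 2 else 0 :: nat) \<noteq> 0"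
   and e: "(if x = a then 1 else if x = b then 2 else 0 :: nat) = (if y = a then 1 else if y = b then 2 else 0)"
  from x have x: "x = a \<or> x = b" by presburger
  from y have y: "y = a \<or> y = b" by presburger
  show "x = y"
    using x y e by (cases "a = b") auto
qed

lemma exists_perm_two:
  fixes a b n :: nat
  assumes "a \<in> {1..n}" "b \<in> {1..n}" "a \<noteq> b" "n \<ge> 2"
  shows "\<exists>\<sigma>. bij_betw \<sigma> {1..n} {1..n} \<and> \<sigma> a = 1 \<and> \<sigma> b = 2"
proof -
  \<comment> \<open>Marker functions: a permutation carrying one to the other,
    \<open>?f (\<sigma> y) = ?g y\<close>, must send a to 1 and b to 2.\<close>
  let ?f = "\<lambda>x::nat. if x = 1 then 1 else if x = 2 then 2 else 0 :: nat"
  let ?g = "\<lambda>x::nat. if x = a then 1 else if x = b then 2 else 0 :: nat"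
  have c: "compat n ?f ?g"
  proof (rule compatI)
    fix x assume "?f x \<noteq> 0"
    then show "\<exists>z\<in>{1..n}. ?g z = ?f x"
      using assms by (cases "x = 1") (auto intro: bexI[of _ a] bexI[of _ b] split: if_splits)
  next
    fix x assume "?g x \<noteq> 0"
    then show "\<exists>z\<in>{1..n}. ?f z = ?g x"
      using assms by (cases "x = a") (auto intro: bexI[of _ 1] bexI[of _ 2] split: if_splits)
  qed
  from exists_perm[OF c inj_on_two inj_on_two] obtain \<sigma> where \<sigma>: "bij_betw \<sigma> {1..n} {1..n}"
    and eq: "\<forall>y\<in>{1..n}. ?f (\<sigma> y) = ?g y"
    by (elim exE conjE)
  have "\<sigma> a = 1" using bspec[OF eq assms(1)] by presburger
  moreover have "\<sigma> b = 2" using bspec[OF eq assms(2)] assms(3) by presburger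
  ultimately show ?thesis using \<sigma> by blast
qed


section \<open>Generation from permutations and gamma\<close>

lemma Sym_subset: "Sym n \<subseteq> PIstar n"
  unfolding Sym_eq using diagram_in_PIstar compat_perm by blast

lemma gamma12_in_PIstar: "n \<ge> 2 \<Longrightarrow> gamma12 n \<in> PIstar n"
  by (simp add: gamma12_diagram diagram_in_PIstar compat_collapse)

lemma pinv_in_PIstar: "\<alpha> \<in> PIstar n \<Longrightarrow> pinv \<alpha> \<in> PIstar n"
  by (metis PIstar_obtains_diagram pinv_diagram diagram_in_PIstar compat_sym)

lemma compat_comp_left: "bij_betw \<pi> {1..n} {1..n} \<Longrightarrow> compat n f g \<Longrightarrow> compat n (f \<circ> \<pi>) g"
  unfolding compat_def image_comp[symmetric] by (simp add: bij_betw_def)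

lemma compat_comp_right: "bij_betw \<rho> {1..n} {1..n} \<Longrightarrow> compat n f g \<Longrightarrow> compat n f (g \<circ> \<rho>)"
  using compat_comp_left compat_sym by blast

lemma star_perm_both:
  assumes "bij_betw \<pi> {1..n} {1..n}" "bij_betw \<rho> {1..n} {1..n}" "compat n f g"
  shows "star n (star n (diagram n \<pi> id) (diagram n f g)) (diagram n id \<rho>) = diagram n (f \<circ> \<pi>) (g \<circ> \<rho>)"
  using assms by (simp add: star_perm_left star_perm_right compat_comp_left)

text \<open>Working in an arbitrary closed set \<open>K\<close> lets the same argument serve both
  parts of the theorem.\<close>

lemma PIstar_generated:
  assumes n: "n \<ge> 2" and sym: "Sym n \<subseteq> K" and gam: "gamma12 n \<in> K"
    and star: "\<And>x y. x \<in> K \<Longrightarrow> y \<in> K \<Longrightarrow> star n x y \<in> K"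
    and inv: "\<And>x. x \<in> K \<Longrightarrow> pinv x \<in> K"
  shows "PIstar n \<subseteq> K"
proof -
  have perms: "diagram n (f \<circ> \<pi>) (g \<circ> \<rho>) \<in> K"
    if "bij_betw \<pi> {1..n} {1..n}" "bij_betw \<rho> {1..n} {1..n}" "compat n f g" "diagram n f g \<in> K"
    for f g \<pi> \<rho>
    using star_perm_both[OF that(1-3)] star[OF star[OF _ that(4)], of "diagram n \<pi> id" "diagram n id \<rho>"]
      Sym_diagramI[OF that(1)] Sym_diagramI'[OF that(2)] sym by auto
  have swap: "diagram n g f \<in> K" if "diagram n f g \<in> K" for f g
    using inv[OF that] by (simp add: pinv_diagram)
  have collapse: "diagram n (id(b := a)) (id(b := 0)) \<in> K"
    if ab: "a \<in> {1..n}" "b \<in> {1..n}" "a \<noteq> b" for a b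
  proof -
    obtain \<sigma> where \<sigma>: "bij_betw \<sigma> {1..n} {1..n}" "\<sigma> a = 1" "\<sigma> b = 2"
      using exists_perm_two[OF ab n] by blast
    have two: "\<sigma> i = 2 \<longleftrightarrow> i = b" if "i \<in> {1..n}" for i
      using inj_on_eq_iff[OF bij_betw_imp_inj_on[OF \<sigma>(1)] that ab(2)] \<sigma>(3) by simp
    have "diagram n (id(2 := 1) \<circ> \<sigma>) (id(2 := 0) \<circ> \<sigma>) \<in> K"
      by (rule perms[OF \<sigma>(1) \<sigma>(1)]) (use n gam gamma12_diagram[OF n] compat_collapse[of 1 n 2] in auto)
    \<comment> \<open>Since \<sigma> sends a, b to 1, 2, the labels on the left are those on the
      right renamed by \<sigma>.\<close>
    also have "diagram n (id(2 := 1) \<circ> \<sigma>) (id(2 := 0) \<circ> \<sigma>) = diagram n (id(b := a)) (id(b := 0))"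
    proof (rule diagram_relabel[where p = "\<sigma>(0 := 0)"])
      show "inj_on (\<sigma>(0 := 0)) (insert 0 (id(b := a) ` {1..n} \<union> id(b := 0) ` {1..n}))"
        by (rule inj_on_subset[OF inj_on_perm_zero[OF \<sigma>(1)]]) (use ab in auto)
    qed (use two \<sigma> ab in auto)
    finally show ?thesis .
  qed
  have kill: "diagram n (id(b := 0)) (id(b := 0)) \<in> K" if b: "b \<in> {1..n}" for b
  proof -
    have "(if b = 1 then 2 else 1) \<in> {1..n}" "(if b = 1 then 2 else 1) \<noteq> b" using n by auto
    then obtain a where a: "a \<in> {1..n}" "a \<noteq> b" by blast
    note c = compat_collapse[OF a(1) b a(2)]
    \<comment> \<open>The inverse of the collapse times the collapse: a and b are merged only in the
      middle copy, and b is left a singleton on both outer sides.\<close>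
    have "star n (diagram n (id(b := 0)) (id(b := a))) (diagram n (id(b := a)) (id(b := 0))) =
        diagram n (id \<circ> id(b := 0)) (id \<circ> id(b := 0))"
      by (rule star_diagram[OF compat_sym[OF c] c]) simp_all
    then show ?thesis using star[OF swap[OF collapse[OF a(1) b a(2)]] collapse[OF a(1) b a(2)]] by simp
  qed
  \<comment> \<open>\<open>e Z\<close> labels the idempotent that cuts the points of
    \<open>Z\<close> and fixes the others.\<close>
  define e where "e Z = (\<lambda>x. if x \<in> Z then 0 else x)" for Z :: "nat set"
  have idem: "diagram n (e Z) (e Z) \<in> K" if "Z \<subseteq> {1..n}" for Z
    using finite_subset[OF that finite_atLeastAtMost] that
  proof (induction Z)
    case empty
    have "e {} = id" by (auto simp: e_def)
    moreover have "diagram n id id \<in> K" using Sym_diagramI[of id n] sym bij_betw_id by blast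
    ultimately show ?case by (simp only:)
  next
    case (insert b Z)
    have "star n (diagram n (e Z) (e Z)) (diagram n (id(b := 0)) (id(b := 0))) =
        diagram n (id(b := 0) \<circ> e Z) (e Z \<circ> id(b := 0))"
      by (rule star_diagram) (auto simp: e_def compat_def split: if_splits)
    also have "\<dots> = diagram n (e (insert b Z)) (e (insert b Z))"
      by (rule diagram_cong) (auto simp: e_def)
    finally show ?case using star[OF insert.IH kill[of b]] insert.prems by auto
  qed
  have inj: "diagram n f g \<in> K" if c: "compat n f g" and f: "inj_on f {x \<in> {1..n}. f x \<noteq> 0}"
    and g: "inj_on g {x \<in> {1..n}. g x \<noteq> 0}" for f g
  proof -
    obtain \<rho> where \<rho>: "bij_betw \<rho> {1..n} {1..n}" "\<forall>y\<in>{1..n}. f (\<rho> y) = g y"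
      using exists_perm[OF c f g] by blast
    let ?Z = "{x \<in> {1..n}. f x = 0}"
    \<comment> \<open>Off its zeros f is injective, so renaming turns its idempotent into a cut at
      the zeros of f; composing with \<rho> on the right then replaces the second f by g.\<close>
    have "diagram n f f = diagram n (e ?Z) (e ?Z)"
    proof (rule diagram_relabel[where p = "f(0 := 0)"])
      show "inj_on (f(0 := 0)) (insert 0 (e ?Z ` {1..n} \<union> e ?Z ` {1..n}))"
        using f unfolding inj_on_def e_def by auto
    qed (auto simp: e_def)
    moreover have "diagram n (e ?Z) (e ?Z) \<in> K" by (rule idem) blast
    ultimately have "diagram n f f \<in> K" by simp
    then have "diagram n (f \<circ> id) (f \<circ> \<rho>) \<in> K"
      by (intro perms) (use \<rho>(1) in \<open>simp_all add: compat_def\<close>)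
    also have "diagram n (f \<circ> id) (f \<circ> \<rho>) = diagram n f g" by (rule diagram_cong) (use \<rho>(2) in auto)
    finally show ?thesis .
  qed
  have merge: "diagram n f g \<in> K"
    if ab: "a \<in> {1..n}" "b \<in> {1..n}" "a \<noteq> b" "f a = f b" and c: "compat n (f(b := 0)) g"
      and K: "diagram n (f(b := 0)) g \<in> K" for f g a b
  proof -
    \<comment> \<open>Multiplying by the collapse on the left puts b back: its X' side leaves b
      isolated just where f has been zeroed, and its X side attaches b to a.\<close>
    have "star n (diagram n (id(b := a)) (id(b := 0))) (diagram n (f(b := 0)) g) =
        diagram n (f(b := 0, 0 := 0) \<circ> id(b := a)) (id \<circ> g)"
      by (rule star_diagram[OF compat_collapse[OF ab(1-3)] c]) auto
    also have "\<dots> = diagram n f g" by (rule diagram_cong) (use ab in auto)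
    finally show ?thesis using star[OF collapse[OF ab(1-3)] K] by simp
  qed
  \<comment> \<open>The point a keeps the label that b loses, so the label set, and with it
    \<open>compat\<close>, is preserved while the support strictly shrinks.\<close>
  have remove: "compat n (f(b := 0)) g" "card {x \<in> {1..n}. (f(b := 0)) x \<noteq> 0} < card {x \<in> {1..n}. f x \<noteq> 0}"
    if ab: "a \<in> {1..n}" "b \<in> {1..n}" "a \<noteq> b" "f a = f b" "f b \<noteq> 0" and c: "compat n f g" for f g a b
  proof -
    have eqI: "A - {0} = B - {0}" if "A \<subseteq> B" "B \<subseteq> insert 0 A" for A B :: "nat set"
      using that by blast
    have "f ` {1..n} - {0} = f(b := 0) ` {1..n} - {0}"
    proof (rule eqI)
      show "f ` {1..n} \<subseteq> f(b := 0) ` {1..n}"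
      proof (rule image_subsetI)
        fix x assume x: "x \<in> {1..n}"
        show "f x \<in> f(b := 0) ` {1..n}"
          by (rule image_eqI[of _ _ "if x = b then a else x"]) (use x ab in auto)
      qed
      show "f(b := 0) ` {1..n} \<subseteq> insert 0 (f ` {1..n})" by auto
    qed
    then show "compat n (f(b := 0)) g" using c by (simp only: compat_def)
    show "card {x \<in> {1..n}. (f(b := 0)) x \<noteq> 0} < card {x \<in> {1..n}. f x \<noteq> 0}"
      by (rule psubset_card_mono) (use ab in auto)
  qed
  \<comment> \<open>The measure counts the points on both sides that lie on lines. A repeated label
    on the X' side is handled by passing to the inverse.\<close>
  have "diagram n f g \<in> K" if "compat n f g" for f g
    using that
  proof (induction "card {x \<in> {1..n}. f x \<noteq> 0} + card {x \<in> {1..n}. g x \<noteq> 0}" arbitrary: f g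
      rule: less_induct)
    case less
    note c = less.prems
    consider "inj_on f {x \<in> {1..n}. f x \<noteq> 0}" "inj_on g {x \<in> {1..n}. g x \<noteq> 0}"
      | a b where "a \<in> {1..n}" "b \<in> {1..n}" "a \<noteq> b" "f a = f b" "f b \<noteq> 0"
      | a b where "a \<in> {1..n}" "b \<in> {1..n}" "a \<noteq> b" "g a = g b" "g b \<noteq> 0"
      unfolding inj_on_def by blast
    then show ?case
    proof cases
      case 1
      then show ?thesis using inj c by blast
    next
      case 2
      note rem = remove[OF 2 c]
      show ?thesis by (rule merge[OF 2(1-4) rem(1)], rule less.hyps[OF _ rem(1)]) (use rem(2) in simp)
    next
      case 3
      note rem = remove[OF 3 compat_sym[OF c]]
      have "diagram n f (g(b := 0)) \<in> K"
        by (rule less.hyps[OF _ compat_sym[OF rem(1)]]) (use rem(2) in simp)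
      then show ?thesis by (rule swap[OF merge[OF 3(1-4) rem(1) swap]])
    qed
  qed
  then show ?thesis using PIstar_obtains_diagram by (metis subsetI)
qed


section \<open>Closed sets and products of arbitrary elements\<close>

lemma inv_gen_subset:
  assumes "G \<subseteq> T" "\<And>x y. x \<in> T \<Longrightarrow> y \<in> T \<Longrightarrow> star n x y \<in> T" "\<And>x. x \<in> T \<Longrightarrow> pinv x \<in> T"
  shows "inv_gen n G \<subseteq> T"
proof
  fix x assume "x \<in> inv_gen n G"
  then show "x \<in> T" by induction (use assms in blast)+
qed

definition product_block :: "nat \<Rightarrow> bpart \<Rightarrow> bpart \<Rightarrow> pt \<Rightarrow> pt set" where
  "product_block n \<alpha> \<beta> u = (if good \<alpha> \<beta> u then {v \<in> ground n. (u, v) \<in> sim \<alpha> \<beta>} else {u})"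

lemma star_product_block: "star n \<alpha> \<beta> = product_block n \<alpha> \<beta> ` ground n"
  unfolding star_eq product_block_def ..

lemma product_block_self: "u \<in> ground n \<Longrightarrow> u \<in> product_block n \<alpha> \<beta> u"
  by (simp add: product_block_def sim_refl)

lemma product_block_sim:
  assumes "(u, v) \<in> sim \<alpha> \<beta>" "good \<alpha> \<beta> u"
  shows "product_block n \<alpha> \<beta> v = product_block n \<alpha> \<beta> u"
proof -
  have "(u, w) \<in> sim \<alpha> \<beta> \<longleftrightarrow> (v, w) \<in> sim \<alpha> \<beta>" for w
    using assms(1) sim_sym sim_trans by blast
  then show ?thesis using assms good_cong[OF assms(1)] by (simp add: product_block_def)
qed

lemma product_block_eq: "w \<in> product_block n \<alpha> \<beta> u \<Longrightarrow> product_block n \<alpha> \<beta> w = product_block n \<alpha> \<beta> u"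
proof (cases "good \<alpha> \<beta> u")
  case True
  assume "w \<in> product_block n \<alpha> \<beta> u"
  then have "(u, w) \<in> sim \<alpha> \<beta>" using True by (simp add: product_block_def)
  then show ?thesis using True by (rule product_block_sim)
qed (simp add: product_block_def)

lemma PIstar_block: "\<alpha> \<in> PIstar n \<Longrightarrow> p \<in> ground n \<Longrightarrow> \<exists>B\<in>\<alpha>. p \<in> B"
  using PIstar_Union by blast

text \<open>All blocks met by a good class are lines, so each leads across. From u one passes to the
  middle copy, then through \<alpha> to X and through \<beta> to X'.\<close>

lemma good_meets_both:
  assumes \<alpha>: "\<alpha> \<in> PIstar n" and \<beta>: "\<beta> \<in> PIstar n" and u: "u \<in> ground n" and good: "good \<alpha> \<beta> u"
  shows "\<exists>x\<in>{1..n}. (u, (x, 0)) \<in> sim \<alpha> \<beta>" "\<exists>y\<in>{1..n}. (u, (y, Suc 0)) \<in> sim \<alpha> \<beta>"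
proof -
  have up: "\<exists>x\<in>{1..n}. (u, up (x, t)) \<in> sim \<alpha> \<beta>"
    if p: "p \<in> ground n" and s: "(u, up p) \<in> sim \<alpha> \<beta>" and t: "t = 0 \<or> t = Suc 0" for p t
  proof -
    obtain B where B: "B \<in> \<alpha>" "p \<in> B" using PIstar_block[OF \<alpha> p] by blast
    have "\<nexists>x. B = {x}" using not_good_up[of p \<alpha> u \<beta>] B s good by auto
    then obtain x where "x \<in> {1..n}" "(x, t) \<in> B" using PIstar_line[OF \<alpha> B(1)] t by blast
    then show ?thesis using sim_trans[OF s sim_up[OF B]] by blast
  qed
  have dn: "\<exists>x\<in>{1..n}. (u, dn (x, t)) \<in> sim \<alpha> \<beta>"
    if p: "p \<in> ground n" and s: "(u, dn p) \<in> sim \<alpha> \<beta>" and t: "t = 0 \<or> t = Suc 0" for p t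
  proof -
    obtain B where B: "B \<in> \<beta>" "p \<in> B" using PIstar_block[OF \<beta> p] by blast
    have "\<nexists>x. B = {x}" using not_good_dn[of p \<beta> u \<alpha>] B s good by auto
    then obtain x where "x \<in> {1..n}" "(x, t) \<in> B" using PIstar_line[OF \<beta> B(1)] t by blast
    then show ?thesis using sim_trans[OF s sim_dn[OF B]] by blast
  qed
  obtain i t where ut: "u = (i, t)" by force
  have i: "i \<in> {1..n}" and t: "t = 0 \<or> t = Suc 0" using u ut by auto
  have "\<exists>z\<in>{1..n}. (u, (z, 2)) \<in> sim \<alpha> \<beta>"
    using t up[OF u, of "Suc 0"] dn[OF u, of 0] sim_refl[of u] ut by auto
  then obtain z where z: "z \<in> {1..n}" "(u, up (z, Suc 0)) \<in> sim \<alpha> \<beta>" "(u, dn (z, 0)) \<in> sim \<alpha> \<beta>"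
    by auto
  show "\<exists>x\<in>{1..n}. (u, (x, 0)) \<in> sim \<alpha> \<beta>" using up[OF _ z(2), of 0] z(1) by simp
  show "\<exists>y\<in>{1..n}. (u, (y, Suc 0)) \<in> sim \<alpha> \<beta>" using dn[OF _ z(3), of "Suc 0"] z(1) by simp
qed

text \<open>Identifications may alternate between the factors, beyond the one-step condition of
  \<open>star_diagram\<close>, so the classes are treated directly: bad points are isolated and good
  classes meet both sides.\<close>

lemma star_in_PIstar:
  assumes \<alpha>: "\<alpha> \<in> PIstar n" and \<beta>: "\<beta> \<in> PIstar n"
  shows "star n \<alpha> \<beta> \<in> PIstar n"
proof -
  have "is_partition (ground n) (star n \<alpha> \<beta>)"
    unfolding star_product_block
  proof (rule is_partition_image)
    show "product_block n \<alpha> \<beta> u \<subseteq> ground n" if "u \<in> ground n" for u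
      using that by (auto simp: product_block_def)
  qed (auto simp: product_block_self product_block_eq)
  moreover have "(\<exists>x. B = {x}) \<or> (B \<inter> Xs n \<noteq> {} \<and> B \<inter> Xp n \<noteq> {})" if B: "B \<in> star n \<alpha> \<beta>" for B
  proof -
    obtain u where u: "u \<in> ground n" "B = product_block n \<alpha> \<beta> u" using B unfolding star_product_block by blast
    show ?thesis
    proof (cases "good \<alpha> \<beta> u")
      case False
      then show ?thesis using u by (simp add: product_block_def)
    next
      case True
      obtain x y where "x \<in> {1..n}" "(u, (x, 0)) \<in> sim \<alpha> \<beta>" "y \<in> {1..n}" "(u, (y, Suc 0)) \<in> sim \<alpha> \<beta>"
        using good_meets_both[OF \<alpha> \<beta> u(1) True] by blast
      then have "(x, 0) \<in> B \<inter> Xs n" "(y, Suc 0) \<in> B \<inter> Xp n"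
        using u True by (simp_all add: Xs_def Xp_def product_block_def)
      then show ?thesis by blast
    qed
  qed
  ultimately show ?thesis unfolding PIstar_def by blast
qed

section \<open>Rank\<close>

text \<open>The number of these blocks is the rank.\<close>

definition lines :: "bpart \<Rightarrow> bpart" where
  "lines \<alpha> = {B \<in> \<alpha>. \<nexists>x. B = {x}}"

text \<open>Each nonzero label marks one line, and every line meets X, so the values of f alone
  account for all of them.\<close>

lemma card_lines_diagram:
  assumes c: "compat n f g"
  shows "card (lines (diagram n f g)) = card (f ` {1..n} - {0})"
proof -
  define b where "b l = {v \<in> ground n. lab f g v = l}" for l
  have "inj_on b (f ` {1..n} - {0})"
  proof (rule inj_onI)
    fix k l assume "k \<in> f ` {1..n} - {0}" "b k = b l"
    then obtain x where "x \<in> {1..n}" "k = f x" by blast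
    then have "(x, 0) \<in> b k" by (simp add: b_def)
    then have "(x, 0) \<in> b l" using \<open>b k = b l\<close> by simp
    then show "k = l" using \<open>k = f x\<close> by (simp add: b_def)
  qed
  moreover have "lines (diagram n f g) = b ` (f ` {1..n} - {0})"
  proof
    show "lines (diagram n f g) \<subseteq> b ` (f ` {1..n} - {0})"
    proof
      fix B assume "B \<in> lines (diagram n f g)"
      then have B: "B \<in> diagram n f g" "\<nexists>x. B = {x}" by (auto simp: lines_def)
      obtain u where u: "u \<in> ground n" "B = diagram_block n f g u" using B(1) unfolding diagram_def by blast
      have nz: "lab f g u \<noteq> 0"
      proof
        assume "lab f g u = 0"
        then have "B = {u}" using u(2) by (simp add: diagram_block_def)
        then show False using B(2) by blast
      qed
      obtain x where x: "x \<in> {1..n}" "(x, 0) \<in> B" using PIstar_line(1)[OF diagram_in_PIstar[OF c] B] by blast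
      then have "f x = lab f g u" using u nz by (simp add: diagram_block_def)
      then show "B \<in> b ` (f ` {1..n} - {0})"
        using x nz u by (intro image_eqI[of _ _ "f x"] DiffI imageI) (simp_all add: diagram_block_def b_def)
    qed
    show "b ` (f ` {1..n} - {0}) \<subseteq> lines (diagram n f g)"
    proof (rule image_subsetI)
      fix l assume "l \<in> f ` {1..n} - {0}"
      then obtain x where x: "x \<in> {1..n}" "f x = l" "l \<noteq> 0" by blast
      then have "b l = diagram_block n f g (x, 0)" by (simp add: b_def diagram_block_def)
      then have bl: "b l \<in> diagram n f g" using x(1) by (auto simp: diagram_def)
      have "b l \<noteq> {p}" for p
      proof
        assume p: "b l = {p}"
        then have "lab f g p = 0" using diagram_singleton[OF c, of p] bl by simp
        moreover have "p \<in> b l" using p by simp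
        ultimately show False using x(3) by (simp add: b_def)
      qed
      then show "b l \<in> lines (diagram n f g)" using bl by (simp add: lines_def)
    qed
  qed
  ultimately show ?thesis by (simp add: card_image)
qed

lemma card_lines_pinv: "\<alpha> \<in> PIstar n \<Longrightarrow> card (lines (pinv \<alpha>)) = card (lines \<alpha>)"
proof -
  assume "\<alpha> \<in> PIstar n"
  then obtain f g where fg: "compat n f g" "\<alpha> = diagram n f g" by (rule PIstar_obtains_diagram)
  then show ?thesis
    using card_lines_diagram[OF fg(1)] card_lines_diagram[OF compat_sym[OF fg(1)]]
    by (simp add: pinv_diagram) (simp add: compat_def)
qed

lemma finite_lines: "\<alpha> \<in> PIstar n \<Longrightarrow> finite (lines \<alpha>)"
proof -
  assume "\<alpha> \<in> PIstar n"
  then have "lines \<alpha> \<subseteq> Pow (ground n)" using PIstar_Union unfolding lines_def by blast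
  then show ?thesis by (rule finite_subset) (simp add: finite_ground)
qed

lemma star_line:
  assumes C: "C \<in> lines (star n \<alpha> \<beta>)" and p: "p \<in> C"
  shows "good \<alpha> \<beta> p \<and> C = product_block n \<alpha> \<beta> p"
proof -
  obtain u where "C = product_block n \<alpha> \<beta> u" using C unfolding lines_def star_product_block by blast
  then have "C = product_block n \<alpha> \<beta> p" using product_block_eq p by blast
  moreover have "C \<noteq> {p}" using C unfolding lines_def by blast
  ultimately show ?thesis by (cases "good \<alpha> \<beta> p") (simp_all add: product_block_def)
qed

text \<open>A line of the product meets X in a point whose \<alpha>-block is again a line, since a
  singleton would make the class bad. Product lines meeting the same \<alpha>-line are identified.
  One product line may meet several \<alpha>-lines, hence an injective relation instead of a
  function; X' and \<beta> are treated alike.\<close>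

lemma card_lines_star:
  assumes \<alpha>: "\<alpha> \<in> PIstar n" and \<beta>: "\<beta> \<in> PIstar n"
  shows "card (lines (star n \<alpha> \<beta>)) \<le> card (lines \<alpha>)" "card (lines (star n \<alpha> \<beta>)) \<le> card (lines \<beta>)"
proof -
  have line: "\<exists>x\<in>{1..n}. (x, 0) \<in> C" "\<exists>x\<in>{1..n}. (x, Suc 0) \<in> C" if "C \<in> lines (star n \<alpha> \<beta>)" for C
    using that PIstar_line[OF star_in_PIstar[OF \<alpha> \<beta>], of C] unfolding lines_def by blast+
  show "card (lines (star n \<alpha> \<beta>)) \<le> card (lines \<alpha>)"
  proof (rule card_le_if_inj_on_rel[where r = "\<lambda>C D. \<exists>x\<in>{1..n}. (x, 0) \<in> C \<and> (x, 0) \<in> D"])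
    show "finite (lines \<alpha>)" using \<alpha> by (rule finite_lines)
  next
    fix C assume C: "C \<in> lines (star n \<alpha> \<beta>)"
    then obtain x where x: "x \<in> {1..n}" "(x, 0) \<in> C" using line by blast
    obtain D where D: "D \<in> \<alpha>" "(x, 0) \<in> D" using PIstar_block[OF \<alpha>, of "(x, 0)"] x by auto
    have "\<nexists>p. D = {p}"
      using not_good_up[of "(x, 0)" \<alpha> "(x, 0)" \<beta>] sim_refl[of "(x, 0)"] star_line[OF C x(2)] D by auto
    then show "\<exists>D. D \<in> lines \<alpha> \<and> (\<exists>x\<in>{1..n}. (x, 0) \<in> C \<and> (x, 0) \<in> D)"
      using x D unfolding lines_def by blast
  next
    fix C C' D assume C: "C \<in> lines (star n \<alpha> \<beta>)" "C' \<in> lines (star n \<alpha> \<beta>)" and D: "D \<in> lines \<alpha>"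
      and "\<exists>x\<in>{1..n}. (x, 0) \<in> C \<and> (x, 0) \<in> D" "\<exists>x\<in>{1..n}. (x, 0) \<in> C' \<and> (x, 0) \<in> D"
    then obtain x y where xy: "(x, 0) \<in> C" "(x, 0) \<in> D" "(y, 0) \<in> C'" "(y, 0) \<in> D" by blast
    have "((x, 0), (y, 0)) \<in> sim \<alpha> \<beta>" using sim_up[OF _ xy(2,4)] D by (auto simp: lines_def)
    then show "C = C'"
      using star_line[OF C(1) xy(1)] star_line[OF C(2) xy(3)] product_block_sim by metis
  qed
  show "card (lines (star n \<alpha> \<beta>)) \<le> card (lines \<beta>)"
  proof (rule card_le_if_inj_on_rel[where r = "\<lambda>C D. \<exists>x\<in>{1..n}. (x, Suc 0) \<in> C \<and> (x, Suc 0) \<in> D"])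
    show "finite (lines \<beta>)" using \<beta> by (rule finite_lines)
  next
    fix C assume C: "C \<in> lines (star n \<alpha> \<beta>)"
    then obtain x where x: "x \<in> {1..n}" "(x, Suc 0) \<in> C" using line by blast
    obtain D where D: "D \<in> \<beta>" "(x, Suc 0) \<in> D" using PIstar_block[OF \<beta>, of "(x, Suc 0)"] x by auto
    have "\<nexists>p. D = {p}"
      using not_good_dn[of "(x, Suc 0)" \<beta> "(x, Suc 0)" \<alpha>] sim_refl[of "(x, Suc 0)"]
        star_line[OF C x(2)] D by auto
    then show "\<exists>D. D \<in> lines \<beta> \<and> (\<exists>x\<in>{1..n}. (x, Suc 0) \<in> C \<and> (x, Suc 0) \<in> D)"
      using x D unfolding lines_def by blast
  next
    fix C C' D assume C: "C \<in> lines (star n \<alpha> \<beta>)" "C' \<in> lines (star n \<alpha> \<beta>)" and D: "D \<in> lines \<beta>"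
      and "\<exists>x\<in>{1..n}. (x, Suc 0) \<in> C \<and> (x, Suc 0) \<in> D" "\<exists>x\<in>{1..n}. (x, Suc 0) \<in> C' \<and> (x, Suc 0) \<in> D"
    then obtain x y where xy: "(x, Suc 0) \<in> C" "(x, Suc 0) \<in> D" "(y, Suc 0) \<in> C'" "(y, Suc 0) \<in> D"
      by blast
    have "((x, Suc 0), (y, Suc 0)) \<in> sim \<alpha> \<beta>" using sim_dn[OF _ xy(2,4)] D by (auto simp: lines_def)
    then show "C = C'"
      using star_line[OF C(1) xy(1)] star_line[OF C(2) xy(3)] product_block_sim by metis
  qed
qed

lemma Sym_star: "\<alpha> \<in> Sym n \<Longrightarrow> \<beta> \<in> Sym n \<Longrightarrow> star n \<alpha> \<beta> \<in> Sym n"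
  unfolding Sym_eq using star_perm_left compat_perm bij_betw_trans by blast

lemma Sym_pinv: "\<alpha> \<in> Sym n \<Longrightarrow> pinv \<alpha> \<in> Sym n"
  using Sym_diagramI' unfolding Sym_eq by (auto simp: pinv_diagram)

lemma card_lines_perm: "bij_betw \<pi> {1..n} {1..n} \<Longrightarrow> card (lines (diagram n \<pi> id)) = n"
  using card_lines_diagram[OF compat_perm] by (simp add: bij_betw_def)

lemma card_lines_Sym: "\<alpha> \<in> Sym n \<Longrightarrow> card (lines \<alpha>) = n"
  unfolding Sym_eq using card_lines_perm by blast

lemma card_lines_gamma12:
  assumes "n \<ge> 2"
  shows "card (lines (gamma12 n)) = n - 1"
proof -
  have "card (lines (gamma12 n)) = card (id(2 := 1) ` {1..n} - {0})"
    unfolding gamma12_diagram[OF assms] by (rule card_lines_diagram[OF compat_collapse]) (use assms in auto)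
  also have "id(2 := 1) ` {1..n} - {0} = {1..n} - {2}"
    using assms by (auto simp: image_iff split: if_splits)
  finally show ?thesis using assms by simp
qed

text \<open>By \<open>card_lines_star\<close> the elements of rank at most n - 2 form an ideal, so
  adding the units keeps the set closed. Gamma has rank n - 1, strictly between the two
  parts.\<close>

lemma card_lines_generator:
  assumes n: "n \<ge> 2" and u: "u \<in> PIstar n" and gen: "gamma12 n \<in> inv_gen n (Sym n \<union> {u})"
  shows "n - 1 \<le> card (lines u)"
proof (rule ccontr)
  assume low: "\<not> n - 1 \<le> card (lines u)"
  let ?L = "{\<alpha> \<in> PIstar n. card (lines \<alpha>) \<le> n - 2}"
  have L: "star n \<alpha> \<beta> \<in> ?L" if "\<alpha> \<in> ?L \<and> \<beta> \<in> PIstar n \<or> \<alpha> \<in> PIstar n \<and> \<beta> \<in> ?L" for \<alpha> \<beta>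
    using that star_in_PIstar[of \<alpha> n \<beta>] card_lines_star[of \<alpha> n \<beta>] by auto
  have "inv_gen n (Sym n \<union> {u}) \<subseteq> Sym n \<union> ?L"
  proof (rule inv_gen_subset)
    show "Sym n \<union> {u} \<subseteq> Sym n \<union> ?L" using u low by auto
    show "star n x y \<in> Sym n \<union> ?L" if "x \<in> Sym n \<union> ?L" "y \<in> Sym n \<union> ?L" for x y
      using that Sym_star[of x n y] L[of x y] Sym_subset[of n] by blast
    show "pinv x \<in> Sym n \<union> ?L" if "x \<in> Sym n \<union> ?L" for x
      using that Sym_pinv pinv_in_PIstar card_lines_pinv by (auto simp del: One_nat_def)
  qed
  then have "gamma12 n \<in> Sym n \<or> gamma12 n \<in> ?L" using gen by blast
  then show False using card_lines_gamma12[OF n] card_lines_Sym n by fastforce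
qed

section \<open>A generator must have a singleton and must not be a partial bijection\<close>

lemma gamma12_singleton: "n \<ge> 2 \<Longrightarrow> {(2, Suc 0)} \<in> gamma12 n"
  by (simp add: gamma12_def)

text \<open>If neither factor has a singleton then the glued family has none, so every point is good
  and its product block meets both sides.\<close>

lemma generator_has_singleton:
  assumes n: "n \<ge> 2" and u: "u \<in> PIstar n" and gen: "gamma12 n \<in> inv_gen n (Sym n \<union> {u})"
  shows "\<exists>p. {p} \<in> u"
proof (rule ccontr)
  assume no: "\<nexists>p. {p} \<in> u"
  let ?T = "{\<alpha> \<in> PIstar n. \<forall>p. {p} \<notin> \<alpha>}"
  have "inv_gen n (Sym n \<union> {u}) \<subseteq> ?T"
  proof (rule inv_gen_subset)
    have "{p} \<notin> \<alpha>" if "\<alpha> \<in> Sym n" for \<alpha> p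
      using that unfolding Sym_def by (auto simp: doubleton_eq_iff dest: equalityD1)
    then show "Sym n \<union> {u} \<subseteq> ?T" using Sym_subset u no by blast
  next
    fix x y assume x: "x \<in> ?T" and y: "y \<in> ?T"
    have good: "good x y p" for p
      using singleton_glued[of x n y] PIstar_Union[of x n] PIstar_Union[of y n] x y
      unfolding good_def by blast
    have "{p} \<notin> star n x y" for p
    proof
      assume "{p} \<in> star n x y"
      then obtain v where v: "v \<in> ground n" "{p} = product_block n x y v" unfolding star_product_block by blast
      obtain i j where "i \<in> {1..n}" "(v, (i, 0)) \<in> sim x y" "j \<in> {1..n}" "(v, (j, Suc 0)) \<in> sim x y"
        using good_meets_both[OF _ _ v(1) good] x y by blast
      then have "(i, 0) \<in> {p}" "(j, Suc 0) \<in> {p}" unfolding v(2) product_block_def by (simp_all add: good)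
      then show False by auto
    qed
    then show "star n x y \<in> ?T" using star_in_PIstar x y by blast
  next
    fix x assume x: "x \<in> ?T"
    then obtain f g where fg: "compat n f g" "x = diagram n f g" using PIstar_obtains_diagram by blast
    have "{p} \<notin> diagram n g f" for p
    proof
      assume s: "{p} \<in> diagram n g f"
      then have z: "lab g f p = 0" by (rule diagram_singleton[OF compat_sym[OF fg(1)]])
      obtain i t where p: "p = (i, t)" by force
      have "p \<in> ground n" using s Union_diagram[of n g f] by blast
      then have it: "i \<in> {1..n}" "t = 0 \<or> t = Suc 0" using p by auto
      \<comment> \<open>With t equal to 0 or 1, \<open>1 - t\<close> is the opposite copy: a
        singleton of the inverse reflects to one of \<open>x\<close>.\<close>
      have "lab f g (i, 1 - t) = 0" using z it(2) p by auto
      then have "{(i, 1 - t)} \<in> diagram n f g" by (intro diagram_zero) (use it in auto)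
      then show False using x fg(2) by blast
    qed
    then show "pinv x \<in> ?T" using pinv_in_PIstar[of x n] x by (simp add: fg(2) pinv_diagram)
  qed
  then show False using gen gamma12_singleton[OF n] by blast
qed

text \<open>Within \<open>PIstar n\<close> these are the partial bijections of X, the elements of
  the symmetric inverse monoid.\<close>

definition thin :: "bpart \<Rightarrow> bool" where
  "thin \<alpha> \<longleftrightarrow> (\<forall>B\<in>\<alpha>. \<forall>i j t. (i, t) \<in> B \<longrightarrow> (j, t) \<in> B \<longrightarrow> i = j)"

lemma thin_diagramI:
  assumes f: "inj_on f {x \<in> {1..n}. f x \<noteq> 0}" and g: "inj_on g {x \<in> {1..n}. g x \<noteq> 0}"
  shows "thin (diagram n f g)"
  unfolding thin_def
proof (intro ballI allI impI)
  fix B i j t assume B: "B \<in> diagram n f g" and ij: "(i, t) \<in> B" "(j, t) \<in> B"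
  have gr: "(i, t) \<in> ground n" "(j, t) \<in> ground n" using B ij Union_diagram[of n f g] by blast+
  show "i = j"
  proof (cases "lab f g (i, t) = 0")
    case True
    obtain u where "B = diagram_block n f g u" using B unfolding diagram_def by blast
    then have "B = diagram_block n f g (i, t)" using diagram_block_eq ij(1) by blast
    then show ?thesis using ij True by (simp add: diagram_block_def)
  next
    case False
    then show ?thesis
      using diagram_same_block[OF B ij] inj_onD[OF f, of i j] inj_onD[OF g, of i j] gr by auto
  qed
qed

lemma thin_diagramD:
  assumes "thin (diagram n f g)"
  shows "inj_on f {x \<in> {1..n}. f x \<noteq> 0}" "inj_on g {x \<in> {1..n}. g x \<noteq> 0}"
proof -
  have eq: "i = j" if e: "lab f g (i, t) = lab f g (j, t)" "lab f g (i, t) \<noteq> 0"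
    and g: "(i, t) \<in> ground n" "(j, t) \<in> ground n" for i j t
    using diagram_line[OF g e] assms unfolding thin_def by blast
  show "inj_on f {x \<in> {1..n}. f x \<noteq> 0}"
    by (rule inj_onI, rule eq[of _ 0]) simp_all
  show "inj_on g {x \<in> {1..n}. g x \<noteq> 0}"
    by (rule inj_onI, rule eq[of _ "Suc 0"]) simp_all
qed

text \<open>A line in a product of partial bijections passes through exactly one middle point, which
  can serve as its label on both outer sides.\<close>

lemma thin_star:
  assumes \<alpha>: "\<alpha> \<in> PIstar n" "thin \<alpha>" and \<beta>: "\<beta> \<in> PIstar n" "thin \<beta>"
  shows "thin (star n \<alpha> \<beta>)"
proof -
  obtain f g where fg: "compat n f g" "\<alpha> = diagram n f g" using \<alpha>(1) by (rule PIstar_obtains_diagram)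
  obtain h k where hk: "compat n h k" "\<beta> = diagram n h k" using \<beta>(1) by (rule PIstar_obtains_diagram)
  note fi = thin_diagramD[OF \<alpha>(2)[unfolded fg(2)]] and hi = thin_diagramD[OF \<beta>(2)[unfolded hk(2)]]
  define S where "S = {y \<in> {1..n}. g y \<noteq> 0 \<and> h y \<noteq> 0}"
  \<comment> \<open>\<open>S\<close> holds the middle points lying on lines of both factors.
    \<open>inv m\<close> returns the point of \<open>S\<close> with a given label and 0 for labels
    that stop in the middle; \<open>inv g\<close> and \<open>inv h\<close> form the pushout.\<close>
  define inv where "inv m l = (if l \<in> m ` S then the_inv_into S m l else 0)" for m :: "nat \<Rightarrow> nat" and l
  have gS: "inj_on g S" "inj_on h S"
    using fi hi unfolding S_def by (auto elim: inj_on_subset)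
  have z: "inv g 0 = 0" "inv h 0 = 0" by (auto simp: inv_def S_def)
  have inv: "inv m (m y) = (if y \<in> S then y else 0)"
    if m: "inj_on m {x \<in> {1..n}. m x \<noteq> 0}" "\<And>s. s \<in> S \<Longrightarrow> m s \<noteq> 0" and y: "y \<in> {1..n}" for m y
  proof (cases "y \<in> S")
    case True
    have "inj_on m S" using m(1) by (rule inj_on_subset) (use m(2) in \<open>auto simp: S_def\<close>)
    then show ?thesis using True by (simp add: inv_def the_inv_into_f_f)
  next
    case False
    have "m y \<notin> m ` S"
    proof
      assume "m y \<in> m ` S"
      then obtain s where s: "s \<in> S" "m s = m y" by auto
      have "s = y" by (rule inj_onD[OF m(1) s(2)]) (use s y m(2)[OF s(1)] in \<open>auto simp: S_def\<close>)
      then show False using False s by simp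
    qed
    then show ?thesis using False by (simp add: inv_def)
  qed
  have ig: "inv g (g y) = (if y \<in> S then y else 0)" "inv h (h y) = (if y \<in> S then y else 0)"
    if "y \<in> {1..n}" for y
    using inv[OF fi(2) _ that] inv[OF hi(1) _ that] by (auto simp: S_def)
  have "star n \<alpha> \<beta> = diagram n (inv g \<circ> f) (inv h \<circ> k)"
    unfolding fg(2) hk(2)
  proof (rule star_diagram[where q = "inv g" and r = "inv h", OF fg(1) hk(1) z])
    fix y assume y: "y \<in> {1..n}"
    show "inv g (g y) = inv h (h y)" using ig[OF y] by simp
    show "inv g (g y) = 0 \<Longrightarrow> g y = 0 \<or> h y = 0"
      using ig[OF y] y by (auto simp: S_def split: if_splits)
    fix x assume x: "x \<in> {1..n}"
    show "inv g (g y) = inv g (g x) \<Longrightarrow> inv g (g y) \<noteq> 0 \<Longrightarrow> g y = g x \<or> h y = h x"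
      using ig(1)[OF y] ig(1)[OF x] by (auto split: if_splits)
  qed
  moreover have "inj_on (inv m \<circ> f') {x \<in> {1..n}. (inv m \<circ> f') x \<noteq> 0}"
    if m: "inj_on m S" "\<And>s. s \<in> S \<Longrightarrow> m s \<noteq> 0" and f': "inj_on f' {x \<in> {1..n}. f' x \<noteq> 0}" for m f'
  proof (rule inj_onI)
    fix x y assume x: "x \<in> {x \<in> {1..n}. (inv m \<circ> f') x \<noteq> 0}" and y: "y \<in> {x \<in> {1..n}. (inv m \<circ> f') x \<noteq> 0}"
      and e: "(inv m \<circ> f') x = (inv m \<circ> f') y"
    have xy: "f' x \<in> m ` S" "f' y \<in> m ` S" using x y by (auto simp: inv_def split: if_splits)
    then have "the_inv_into S m (f' x) = the_inv_into S m (f' y)" using e by (simp add: inv_def)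
    then have "f' x = f' y"
      using inj_onD[OF inj_on_the_inv_into[OF m(1)]] xy by blast
    then show "x = y"
      by (rule inj_onD[OF f']) (use x y xy m(2) in auto)
  qed
  then have "thin (diagram n (inv g \<circ> f) (inv h \<circ> k))"
    using gS fi(1) hi(2) by (intro thin_diagramI) (auto simp: S_def)
  ultimately show ?thesis by simp
qed

lemma generator_not_thin:
  assumes n: "n \<ge> 2" and u: "u \<in> PIstar n" and gen: "gamma12 n \<in> inv_gen n (Sym n \<union> {u})"
  shows "\<not> thin u"
proof
  assume thin: "thin u"
  have "inv_gen n (Sym n \<union> {u}) \<subseteq> {\<alpha> \<in> PIstar n. thin \<alpha>}"
  proof (rule inv_gen_subset)
    have "thin \<alpha>" if "\<alpha> \<in> Sym n" for \<alpha>
      using that thin_diagramI unfolding Sym_eq by (auto simp: bij_betw_def elim!: inj_on_subset intro!: thin_diagramI)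
    then show "Sym n \<union> {u} \<subseteq> {\<alpha> \<in> PIstar n. thin \<alpha>}" using Sym_subset u thin by blast
    show "star n x y \<in> {\<alpha> \<in> PIstar n. thin \<alpha>}"
      if "x \<in> {\<alpha> \<in> PIstar n. thin \<alpha>}" "y \<in> {\<alpha> \<in> PIstar n. thin \<alpha>}" for x y
      using that star_in_PIstar thin_star by blast
    fix x assume x: "x \<in> {\<alpha> \<in> PIstar n. thin \<alpha>}"
    then obtain f g where fg: "compat n f g" "x = diagram n f g" using PIstar_obtains_diagram by blast
    have "thin (diagram n g f)" using thin_diagramI thin_diagramD x fg(2) by blast
    then show "pinv x \<in> {\<alpha> \<in> PIstar n. thin \<alpha>}" using pinv_in_PIstar[of x n] x by (simp add: fg(2) pinv_diagram)
  qed
  then have "thin (gamma12 n)" using gen by blast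
  moreover have "{(1, 0), (2, 0), (1, 1)} \<in> gamma12 n" by (simp add: gamma12_def)
  ultimately have "i = j" if "(i, 0::nat) \<in> {(1, 0), (2, 0), (1, 1)}" "(j, 0::nat) \<in> {(1, 0), (2, 0), (1, 1)}"
    for i j :: nat
    using that unfolding thin_def by metis
  from this[of 1 2] show False by simp
qed

section \<open>Elements of rank n - 1 and double cosets of the permutations\<close>

text \<open>As b repeats the label of a, the n - 1 points other than b already supply at least n - 1
  nonzero labels, so f is injective there and never 0. The zero is then a value of g at some d, and
  the same count makes g injective away from d.\<close>

lemma diagram_double_coset:
  assumes n: "n \<ge> 2" and c: "compat n f g" and rank: "n - 1 \<le> card (f ` {1..n} - {0})"
    and ab: "a \<in> {1..n}" "b \<in> {1..n}" "a \<noteq> b" "f a = f b" "f b \<noteq> 0"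
    and zero: "\<exists>d\<in>{1..n}. f d = 0 \<or> g d = 0"
  shows "\<exists>\<sigma> \<tau>. bij_betw \<sigma> {1..n} {1..n} \<and> bij_betw \<tau> {1..n} {1..n} \<and>
    diagram n f g = diagram n (id(2 := 1) \<circ> \<sigma>) (id(2 := 0) \<circ> \<tau>)"
proof -
  have small: "inj_on h ({1..n} - {c}) \<and> 0 \<notin> h ` ({1..n} - {c})"
    if h: "n - 1 \<le> card (h ` ({1..n} - {c}) - {0})" and c: "c \<in> {1..n}" for h :: "nat \<Rightarrow> nat" and c
  proof -
    let ?A = "{1..n} - {c}"
    have A: "finite ?A" "card ?A = n - 1" using c by auto
    have "card (h ` ?A - {0}) \<le> card (h ` ?A)" "card (h ` ?A) \<le> card ?A"
      by (auto intro: card_mono card_image_le)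
    then have e: "card (h ` ?A) = card ?A" "card (h ` ?A - {0}) = card (h ` ?A)" using h A by linarith+
    have "h ` ?A - {0} = h ` ?A" by (rule card_subset_eq) (use e A in auto)
    then show ?thesis using eq_card_imp_inj_on[OF A(1) e(1)] by blast
  qed
  have fb: "f ` {1..n} = f ` ({1..n} - {b})"
  proof
    show "f ` {1..n} \<subseteq> f ` ({1..n} - {b})"
    proof (rule image_subsetI)
      fix x assume "x \<in> {1..n}"
      then show "f x \<in> f ` ({1..n} - {b})"
        using ab by (intro image_eqI[of _ _ "if x = b then a else x"]) auto
    qed
  qed auto
  have "n - 1 \<le> card (f ` ({1..n} - {b}) - {0})" using rank by (simp only: fb)
  from small[OF this ab(2)] have f: "inj_on f ({1..n} - {b})" "0 \<notin> f ` ({1..n} - {b})"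
    by simp_all
  then have fnz: "f x \<noteq> 0" if "x \<in> {1..n}" for x using that ab by (cases "x = b") force+
  then obtain d where d: "d \<in> {1..n}" "g d = 0" using zero by blast
  have "g ` {1..n} - {0} = g ` ({1..n} - {d}) - {0}" using d by auto
  then have "n - 1 \<le> card (g ` ({1..n} - {d}) - {0})" using rank c by (simp only: compat_def)
  from small[OF this d(1)] have g: "inj_on g ({1..n} - {d})" by simp
  have cb: "compat n (f(b := 0)) g"
  proof -
    have "f(b := 0) ` {1..n} - {0} = f ` ({1..n} - {b}) - {0}" by auto
    then show ?thesis using fb c by (simp add: compat_def)
  qed
  have "inj_on (f(b := 0)) ({1..n} - {b})"
    using f(1) by (rule inj_on_cong[THEN iffD1, rotated]) simp
  then have fi: "inj_on (f(b := 0)) {x \<in> {1..n}. (f(b := 0)) x \<noteq> 0}"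
    by (rule inj_on_subset) auto
  have gi: "inj_on g {x \<in> {1..n}. g x \<noteq> 0}"
    using g by (rule inj_on_subset) (use d in auto)
  \<comment> \<open>Once f is zeroed at b it has a single zero, as g has; \<rho> matches equal
    labels and sends d to b.\<close>
  from exists_perm[OF cb fi gi] obtain \<rho>
    where \<rho>: "bij_betw \<rho> {1..n} {1..n}" "\<forall>y\<in>{1..n}. (f(b := 0)) (\<rho> y) = g y"
    by (elim exE conjE)
  obtain \<sigma> where \<sigma>: "bij_betw \<sigma> {1..n} {1..n}" "\<sigma> a = 1" "\<sigma> b = 2"
    using exists_perm_two[OF ab(1-3) n] by blast
  have two: "\<sigma> i = 2 \<longleftrightarrow> i = b" if "i \<in> {1..n}" for i
    using inj_on_eq_iff[OF bij_betw_imp_inj_on[OF \<sigma>(1)] that ab(2)] \<sigma>(3) by simp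
  \<comment> \<open>Renames labels to match gamma: the label of each x other than b becomes \<sigma>
    x, so the label shared by a and b becomes 1.\<close>
  define \<theta> where "\<theta> l = (if l = 0 then 0 else \<sigma> (the_inv_into ({1..n} - {b}) f l))" for l
  have \<theta>: "\<theta> (f x) = \<sigma> x" if "x \<in> {1..n} - {b}" for x
    using that fnz[of x] the_inv_into_f_f[OF f(1) that] by (simp add: \<theta>_def)
  have F: "\<theta> (f x) = (id(2 := 1) \<circ> \<sigma>) x" if x: "x \<in> {1..n}" for x
  proof (cases "x = b")
    case True
    then show ?thesis using \<theta>[of a] ab \<sigma> by auto
  next
    case False
    then show ?thesis using \<theta>[of x] x two[OF x] by auto
  qed
  have G: "\<theta> (g y) = (id(2 := 0) \<circ> (\<sigma> \<circ> \<rho>)) y" if y: "y \<in> {1..n}" for y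
  proof -
    have r: "\<rho> y \<in> {1..n}" using bij_betw_apply[OF \<rho>(1) y] .
    have gy: "g y = (f(b := 0)) (\<rho> y)" using \<rho>(2) y by simp
    show ?thesis
    proof (cases "\<rho> y = b")
      case True
      then show ?thesis using gy \<sigma> by (simp add: \<theta>_def)
    next
      case False
      then show ?thesis using gy \<theta>[of "\<rho> y"] r two[OF r] by auto
    qed
  qed
  have "diagram n (id(2 := 1) \<circ> \<sigma>) (id(2 := 0) \<circ> (\<sigma> \<circ> \<rho>)) = diagram n f g"
  proof (rule diagram_relabel[where p = \<theta>])
    have "g y \<in> insert 0 (f ` {1..n})" if "y \<in> {1..n}" for y
      using compatD2[OF c that] by (metis imageI insertI1 insertI2)
    then have "g ` {1..n} \<subseteq> insert 0 (f ` {1..n})" by (rule image_subsetI)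
    then have sub: "insert 0 (f ` {1..n} \<union> g ` {1..n}) \<subseteq> insert 0 (f ` ({1..n} - {b}))"
      unfolding fb by (intro iffD2[OF insert_subset] conjI Un_least subset_insertI insertI1)
    have im: "\<theta> l \<noteq> 0" if "l \<in> f ` ({1..n} - {b})" for l
    proof -
      obtain x where "x \<in> {1..n} - {b}" "l = f x" using \<open>l \<in> _\<close> by blast
      then show ?thesis using \<theta> bij_betw_apply[OF \<sigma>(1), of x] by auto
    qed
    have "inj_on \<theta> (f ` ({1..n} - {b}))"
    proof (rule inj_onI)
      fix k l assume "k \<in> f ` ({1..n} - {b})" "l \<in> f ` ({1..n} - {b})" and e: "\<theta> k = \<theta> l"
      then obtain x y where xy: "x \<in> {1..n} - {b}" "k = f x" "y \<in> {1..n} - {b}" "l = f y" by blast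
      then have "\<sigma> x = \<sigma> y" using e \<theta> by simp
      then show "k = l" using inj_onD[OF bij_betw_imp_inj_on[OF \<sigma>(1)]] xy by blast
    qed
    moreover have "\<theta> 0 = 0" by (simp add: \<theta>_def)
    moreover have "0 \<notin> \<theta> ` (f ` ({1..n} - {b}))" using im by force
    then have "0 \<notin> \<theta> ` (f ` ({1..n} - {b}) - {0})"
      by (rule contra_subsetD[OF image_mono[OF Diff_subset]])
    ultimately have "inj_on \<theta> (insert 0 (f ` ({1..n} - {b})))" by (simp only: inj_on_insert simp_thms)
    then show "inj_on \<theta> (insert 0 (f ` {1..n} \<union> g ` {1..n}))" using sub by (rule inj_on_subset)
  qed (use F G in \<open>simp_all add: \<theta>_def\<close>)
  then show ?thesis using \<sigma>(1) bij_betw_trans[OF \<rho>(1) \<sigma>(1)] by metis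
qed

definition double_coset :: "nat \<Rightarrow> bpart \<Rightarrow> bpart set" where
  "double_coset n v = {star n (star n g v) h | g h. g \<in> Sym n \<and> h \<in> Sym n}"

lemma diagram_in_double_coset:
  assumes "bij_betw \<pi> {1..n} {1..n}" "bij_betw \<rho> {1..n} {1..n}" "compat n f g"
  shows "diagram n (f \<circ> \<pi>) (g \<circ> \<rho>) \<in> double_coset n (diagram n f g)"
  unfolding double_coset_def star_perm_both[OF assms, symmetric]
  using Sym_diagramI[OF assms(1)] Sym_diagramI'[OF assms(2)] by blast

text \<open>Multiplying by the inverse permutations cancels the outer factors. This turns u in the
  double coset of gamma into gamma in the double coset of u, which is what generation needs.\<close>

lemma double_coset_sym:
  assumes c: "compat n f g" and u: "u \<in> double_coset n (diagram n f g)"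
  shows "diagram n f g \<in> double_coset n u"
proof -
  obtain \<pi> \<pi>' where \<pi>: "bij_betw \<pi> {1..n} {1..n}" "bij_betw \<pi>' {1..n} {1..n}"
    and u: "u = star n (star n (diagram n \<pi> id) (diagram n f g)) (diagram n \<pi>' id)"
    using u unfolding double_coset_def Sym_eq by blast
  \<comment> \<open>The right factor carries its permutation on the X side; inverting moves it to
    the X' side, as \<open>star_perm_both\<close> expects.\<close>
  define \<rho> where "\<rho> = the_inv_into {1..n} \<pi>'"
  have \<rho>: "bij_betw \<rho> {1..n} {1..n}" unfolding \<rho>_def using \<pi>(2) by (rule bij_betw_the_inv_into)
  have u: "u = diagram n (f \<circ> \<pi>) (g \<circ> \<rho>)"
    unfolding u diagram_perm_id[OF \<pi>(2)] \<rho>_def[symmetric] by (rule star_perm_both[OF \<pi>(1) \<rho> c])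
  let ?p = "the_inv_into {1..n} \<pi>" and ?r = "the_inv_into {1..n} \<rho>"
  have "diagram n (f \<circ> \<pi> \<circ> ?p) (g \<circ> \<rho> \<circ> ?r) \<in> double_coset n u"
    unfolding u
    by (intro diagram_in_double_coset bij_betw_the_inv_into \<pi>(1) \<rho> compat_comp_left compat_comp_right c)
  also have "diagram n (f \<circ> \<pi> \<circ> ?p) (g \<circ> \<rho> \<circ> ?r) = diagram n f g"
  proof (rule diagram_cong)
    fix i assume i: "i \<in> {1..n}"
    show "(f \<circ> \<pi> \<circ> ?p) i = f i" using f_the_inv_into_f_bij_betw[OF \<pi>(1), of i] i by simp
    show "(g \<circ> \<rho> \<circ> ?r) i = g i" using f_the_inv_into_f_bij_betw[OF \<rho>, of i] i by simp
  qed
  finally show ?thesis .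
qed

lemma generator_in_double_coset:
  assumes n: "n \<ge> 2" and u: "u \<in> PIstar n" and gen: "gamma12 n \<in> inv_gen n (Sym n \<union> {u})"
  shows "u \<in> double_coset n (gamma12 n) \<union> double_coset n (pinv (gamma12 n))"
proof -
  obtain f g where c: "compat n f g" and fg: "u = diagram n f g" using u by (rule PIstar_obtains_diagram)
  have rank: "n - 1 \<le> card (f ` {1..n} - {0})"
    using card_lines_generator[OF assms] card_lines_diagram[OF c] fg by simp
  obtain p where p: "{p} \<in> diagram n f g" using generator_has_singleton[OF assms] fg by blast
  then have "p \<in> ground n" "lab f g p = 0" using Union_diagram[of n f g] diagram_singleton[OF c] by blast+
  then have zero: "\<exists>d\<in>{1..n}. f d = 0 \<or> g d = 0" by (cases p) (force intro: bexI[of _ "fst p"])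
  have "\<not> (inj_on f {x \<in> {1..n}. f x \<noteq> 0} \<and> inj_on g {x \<in> {1..n}. g x \<noteq> 0})"
    using generator_not_thin[OF assms] thin_diagramI fg by blast
  then consider a b where "a \<in> {1..n}" "b \<in> {1..n}" "a \<noteq> b" "f a = f b" "f b \<noteq> 0"
    | a b where "a \<in> {1..n}" "b \<in> {1..n}" "a \<noteq> b" "g a = g b" "g b \<noteq> 0"
    unfolding inj_on_def by force
  then show ?thesis
  proof cases
    case 1
    obtain \<sigma> \<tau> where st: "bij_betw \<sigma> {1..n} {1..n}" "bij_betw \<tau> {1..n} {1..n}"
      "diagram n f g = diagram n (id(2 := 1) \<circ> \<sigma>) (id(2 := 0) \<circ> \<tau>)"
      using diagram_double_coset[OF n c rank 1 zero] by blast
    have "u \<in> double_coset n (gamma12 n)"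
      unfolding fg st(3) gamma12_diagram[OF n]
      by (rule diagram_in_double_coset[OF st(1,2) compat_collapse]) (use n in auto)
    then show ?thesis by blast
  next
    \<comment> \<open>The mirror image: the first case applied to the inverse of u, which exchanges
      gamma with its inverse.\<close>
    case 2
    have rank': "n - 1 \<le> card (g ` {1..n} - {0})" using rank c by (simp add: compat_def)
    have zero': "\<exists>d\<in>{1..n}. g d = 0 \<or> f d = 0" using zero by blast
    obtain \<sigma> \<tau> where st: "bij_betw \<sigma> {1..n} {1..n}" "bij_betw \<tau> {1..n} {1..n}"
      "diagram n g f = diagram n (id(2 := 1) \<circ> \<sigma>) (id(2 := 0) \<circ> \<tau>)"
      using diagram_double_coset[OF n compat_sym[OF c] rank' 2 zero'] by blast
    have "u = diagram n (id(2 := 0) \<circ> \<tau>) (id(2 := 1) \<circ> \<sigma>)"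
      using arg_cong[OF st(3), of pinv] fg by (simp add: pinv_diagram)
    then have "u \<in> double_coset n (pinv (gamma12 n))"
      unfolding gamma12_diagram[OF n] pinv_diagram
      using diagram_in_double_coset[OF st(2,1) compat_sym[OF compat_collapse[of 1 n 2]]] n by simp
    then show ?thesis by blast
  qed
qed

section \<open>Conclusion\<close>

text \<open>Reduces each generation claim to finding gamma in the generated set.\<close>

lemma inv_gen_PIstar:
  assumes n: "n \<ge> 2" and G: "Sym n \<subseteq> G" "G \<subseteq> PIstar n" and gam: "gamma12 n \<in> inv_gen n G"
  shows "inv_gen n G = PIstar n"
proof
  show "inv_gen n G \<subseteq> PIstar n"
    using G(2) star_in_PIstar pinv_in_PIstar by (rule inv_gen_subset)
  show "PIstar n \<subseteq> inv_gen n G"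
    using n by (rule PIstar_generated) (use G(1) gam in \<open>auto intro: inv_gen.intros\<close>)
qed

theorem mainTheorem4:
  fixes n :: nat
  assumes "n \<ge> 3"
  shows "inv_gen n (Sym n \<union> {gamma12 n}) = PIstar n \<and>
         (\<forall>u \<in> PIstar n - Sym n.
           inv_gen n (Sym n \<union> {u}) = PIstar n \<longleftrightarrow>
           u \<in> {star n (star n g v) h | g v h. g \<in> Sym n \<and> h \<in> Sym n \<and>
                                             v \<in> {gamma12 n, pinv (gamma12 n)}})"
proof (intro conjI ballI)
  have n: "n \<ge> 2" using assms by simp
  note gam = gamma12_in_PIstar[OF n]
  show "inv_gen n (Sym n \<union> {gamma12 n}) = PIstar n"
    by (rule inv_gen_PIstar[OF n]) (use Sym_subset gam in \<open>auto intro: inv_gen.base\<close>)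
  fix u assume "u \<in> PIstar n - Sym n"
  then have u: "u \<in> PIstar n" by simp
  have cosets: "{star n (star n g v) h | g v h. g \<in> Sym n \<and> h \<in> Sym n \<and>
      v \<in> {gamma12 n, pinv (gamma12 n)}} =
    double_coset n (gamma12 n) \<union> double_coset n (pinv (gamma12 n))"
    unfolding double_coset_def by blast
  show "inv_gen n (Sym n \<union> {u}) = PIstar n \<longleftrightarrow>
    u \<in> {star n (star n g v) h | g v h. g \<in> Sym n \<and> h \<in> Sym n \<and> v \<in> {gamma12 n, pinv (gamma12 n)}}"
    unfolding cosets
  proof
    assume "inv_gen n (Sym n \<union> {u}) = PIstar n"
    then show "u \<in> double_coset n (gamma12 n) \<union> double_coset n (pinv (gamma12 n))"
      using generator_in_double_coset[OF n u] gam by simp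
  next
    let ?K = "inv_gen n (Sym n \<union> {u})"
    assume mem: "u \<in> double_coset n (gamma12 n) \<union> double_coset n (pinv (gamma12 n))"
    have coset: "double_coset n u \<subseteq> ?K"
      unfolding double_coset_def by (blast intro: inv_gen.intros)
    have c: "compat n (id(2 := 1)) (id(2 := 0))" using n by (intro compat_collapse) auto
    \<comment> \<open>The double coset of u lies in \<open>?K\<close> and, by symmetry, contains
      gamma or its inverse. Closure under \<open>pinv\<close> makes either one sufficient.\<close>
    have "gamma12 n \<in> ?K \<or> pinv (gamma12 n) \<in> ?K"
      using mem coset double_coset_sym[OF c, of u] double_coset_sym[OF compat_sym[OF c], of u]
      unfolding gamma12_diagram[OF n] pinv_diagram by blast
    moreover have "pinv (pinv (gamma12 n)) = gamma12 n" by (simp add: gamma12_diagram[OF n] pinv_diagram)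
    ultimately have "gamma12 n \<in> ?K" using inv_gen.inv by metis
    then show "?K = PIstar n"
      by (intro inv_gen_PIstar[OF n]) (use Sym_subset u in auto)
  qed
qed

end
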